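(* There is an absolute constant $K>0$, and for every real $z_0\ge 3$ there is a real number $x_0=x_0(z_0)$ depending only on $z_0$, such that the following holds. Let $c>0$ and $z_0\ge 3$ be constants such that $$\pi_{\mathcal T}(z)\;\ge\;\frac{c\,z}{\log^2 z}\qquad\text{for every real } z\ge z_0 .$$ Set $\mathcal R=\{\,n \text{ even}: n=p+t \text{ for some prime } p \text{ and some } t\in\mathcal T\,\}$. Then $$\#\bigl(\mathcal R\cap[1,y]\bigr)\;\ge\;\frac{c}{K}\cdot\frac{y}{2}\qquad\text{for all real } y\ge 2x_0 .$$ Consequently $\mathcal R$ has lower asymptotic density at least $c/K$ inside the even integers: $$\liminf_{y\to\infty}\frac{\#\{n\le y: n\in\mathcal R\}}{y/2}\;\ge\;\frac{c}{K}\;>\;0 .$$ (In particular $K$ is independent of $c$ and of $z_0$.)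
   Context: A prime $t$ is a twin member if $t-2$ or $t+2$ is prime. $\mathcal T$ denotes the set of all twin members, and $\pi_{\mathcal T}(z)=\#\{t\in\mathcal T: t\le z\}$. $\log$ is the natural logarithm. *)

theory Defs
  imports "HOL-Analysis.Analysis" "HOL-Computational_Algebra.Primes"
begin

text \<open>
  The truncated subtraction on \<^typ>\<open>nat\<close> is harmless here: \<open>t\<close> is prime, so \<open>t \<ge> 2\<close>.
\<close>

definition twin_members :: "nat set" where
  "twin_members = {t. prime t \<and> (prime (t - 2) \<or> prime (t + 2))}"

definition twin_count :: "real \<Rightarrow> nat" where
  "twin_count z = card {t \<in> twin_members. real t \<le> z}"

definition prime_plus_twin :: "nat set" where
  "prime_plus_twin = {n. even n \<and> (\<exists>p t. prime p \<and> t \<in> twin_members \<and> n = p + t)}"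

end

theory Submission
  imports Defs "HOL-Number_Theory.Cong" "HOL-Computational_Algebra.Squarefree"
    "HOL-Computational_Algebra.Nth_Powers" "HOL-Real_Asymp.Real_Asymp"
begin

text \<open>
  Let \<open>T\<close> be the set of twin members below \<open>N\<close>, let \<open>M\<close> be its size, and let \<open>P\<close> be the set of odd
  primes between a small power of \<open>N\<close> and \<open>N\<close>. By Cauchy--Schwarz, the number of sums \<open>p + t\<close> with
  \<open>p \<in> P\<close> and \<open>t \<in> T\<close> is at least \<open>(|P| M)\<^sup>2 / E\<close>, where the energy \<open>E\<close> counts the solutions of
  \<open>p + t = p' + s\<close> (\<open>card_squared_le_card_image_mult_energy\<close>). The sums are even, because all
  twin members are odd.

  To obtain a bound that is linear in \<open>c\<close>, the variable \<open>t\<close> in the energy is not sieved: it ranges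
  freely over \<open>T\<close>, and only \<open>(p, s)\<close> is counted for each \<open>t\<close>. Up to replacing \<open>s\<close> by \<open>s - 2\<close> and
  \<open>t\<close> by \<open>t - 2\<close>, the four numbers \<open>p\<close>, \<open>p + t - s\<close>, \<open>s\<close> and \<open>s + 2\<close> are prime, so a sieve of
  dimension four should give at most a constant times \<open>N\<^sup>2 / ln\<^sup>4 N\<close> pairs. The point that makes the
  proof short is that this holds uniformly in the integer \<open>t\<close>, without a singular series: for
  every odd prime \<open>q\<close>, the number of pairs modulo \<open>q\<close> for which \<open>q\<close> divides none of the four forms
  is \<open>(q - 2)\<^sup>2\<close> or \<open>(q - 2)\<^sup>2 + 1\<close>, whatever \<open>t\<close> is (\<open>local_survivors_eq\<close>). Hence \<open>E\<close> is at most a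
  constant times \<open>M N\<^sup>2 / ln\<^sup>4 N\<close>. With Chebyshev's bound \<open>|P| \<ge> N / (8 ln N)\<close> the number of sums is at
  least a constant times \<open>M ln\<^sup>2 N\<close> (\<open>card_sums_ge\<close>), which is at least a constant times \<open>c N\<close> by
  the hypothesis. All constants, and the point from which the estimates hold, are absolute, since
  the hypothesis with its \<open>c\<close> and \<open>z\<^sub>0\<close> enters only in this last step.

  The sieve is Selberg's, applied to finite sets of odd primes in place of squarefree moduli
  (\<open>selberg_sieve\<close>). Its main term is controlled by comparing the sum of the local weights with
  the fourth power of \<open>\<Sum> 1 / s\<close> over odd squarefree \<open>s\<close> (\<open>sum_odd_prime_sets_inverse_power4\<close>),
  and its error term by the Chinese remainder theorem and the periodicity of divisibility
  (\<open>card_divisible_box\<close>); the sieving level is such a small power of \<open>N\<close> that crude bounds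
  on the sieve weights suffice.
\<close>

section \<open>The upper bound sieve of Selberg for families of finite sets\<close>

lemma sum_Pow_prod:
  fixes f :: "'p \<Rightarrow> 'b::comm_ring_1"
  assumes "finite S"
  shows "(\<Sum>T\<in>Pow S. \<Prod>p\<in>T. f p) = (\<Prod>p\<in>S. 1 + f p)"
proof -
  have "(\<Prod>p\<in>S. f p + 1) = (\<Sum>T\<in>Pow S. (\<Prod>p\<in>T. f p) * (\<Prod>p\<in>S-T. 1))"
    using prod_add[OF assms, of f "\<lambda>_. 1"] by simp
  then show ?thesis by (simp add: add.commute)
qed

text \<open>
  Moebius inversion on the lattice of finite sets; it makes the sieve weights below recover the
  minimizer of the diagonalized quadratic form.
\<close>

lemma sum_between_alternating:
  fixes E F :: "'p set"
  assumes "finite F" "E \<subseteq> F"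
  shows "(\<Sum>S | E \<subseteq> S \<and> S \<subseteq> F. (-1) ^ card S) = (if E = F then (-1) ^ card E else (0::real))"
proof -
  have fE: "finite E" using assms finite_subset by blast
  have img: "{S. E \<subseteq> S \<and> S \<subseteq> F} = (\<lambda>U. E \<union> U) ` Pow (F - E)"
  proof (intro equalityI subsetI)
    fix S assume "S \<in> {S. E \<subseteq> S \<and> S \<subseteq> F}"
    then have "S = E \<union> (S - E)" "S - E \<in> Pow (F - E)" by auto
    then show "S \<in> (\<lambda>U. E \<union> U) ` Pow (F - E)" by (rule image_eqI)
  qed (use assms in auto)
  have inj: "inj_on (\<lambda>U. E \<union> U) (Pow (F - E))" by (auto simp: inj_on_def)
  have "(\<Sum>S | E \<subseteq> S \<and> S \<subseteq> F. (-1) ^ card S :: real)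
      = (\<Sum>U\<in>Pow (F - E). (-1) ^ card (E \<union> U))"
    unfolding img by (subst sum.reindex[OF inj]) simp
  also have "\<dots> = (\<Sum>U\<in>Pow (F - E). (-1) ^ card E * (\<Prod>p\<in>U. - 1))"
  proof (rule sum.cong[OF refl])
    fix U assume U: "U \<in> Pow (F - E)"
    then have "finite U" using assms finite_subset[of U F] by auto
    then have "card (E \<union> U) = card E + card U" using U fE by (intro card_Un_disjoint) auto
    then show "(-1) ^ card (E \<union> U) = (-1) ^ card E * (\<Prod>p\<in>U. - 1 :: real)"
      by (simp add: power_add)
  qed
  also have "\<dots> = (-1) ^ card E * (\<Prod>p\<in>F - E. 0)"
    using assms sum_Pow_prod[of "F - E" "\<lambda>_. - 1 :: real"]
    by (simp add: sum_distrib_left[symmetric] del: prod_constant)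
  also have "\<dots> = (if E = F then (-1) ^ card E else 0)"
    using assms by auto
  finally show ?thesis .
qed

text \<open>
  Let \<open>l S\<close> be real weights with \<open>l {} = 1\<close>. Then \<open>(\<Sum> l S)\<^sup>2\<close>, summed over the \<open>S \<in> \<D>\<close> contained in
  \<open>B a\<close>, is at least the indicator of the survivors \<open>a\<close>. Summed over \<open>a\<close>, this majorant gives
  \<open>X\<close> times a quadratic form in \<open>l\<close>, with an error of at most \<open>R (\<Sum> |l S|)\<^sup>2\<close>. Since \<open>g\<close> is
  multiplicative on disjoint sets, the form is diagonal in the
  variables \<open>\<Sum>\<^bsub>S \<supseteq> E\<^esub> l S * prod g S\<close>, with coefficients \<open>1 / h E\<close> where \<open>h = g / (1 - g)\<close>; its
  minimum under \<open>l {} = 1\<close> is \<open>1 / G\<close> with \<open>G = \<Sum> h S\<close>. Here \<open>S\<close> plays the role of the squarefree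
  number \<open>\<Prod>S\<close>, a union that of a least common multiple, and \<open>B a\<close> is the set of primes
  that divide the number attached to \<open>a\<close>.
\<close>

theorem selberg_sieve:
  fixes g :: "'p \<Rightarrow> real" and B :: "'a \<Rightarrow> 'p set" and \<D> :: "'p set set" and X R :: real
  assumes finA: "finite A" and fin\<D>: "finite \<D>" and finS: "\<And>S. S \<in> \<D> \<Longrightarrow> finite S"
    and empty: "{} \<in> \<D>" and down: "\<And>S T. S \<in> \<D> \<Longrightarrow> T \<subseteq> S \<Longrightarrow> T \<in> \<D>"
    and g: "\<And>p. p \<in> \<Union>\<D> \<Longrightarrow> 0 < g p \<and> g p < 1"
    and R: "\<And>S T. S \<in> \<D> \<Longrightarrow> T \<in> \<D> \<Longrightarrow>
              \<bar>real (card {a \<in> A. S \<union> T \<subseteq> B a}) - X * prod g (S \<union> T)\<bar> \<le> R"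
  shows "real (card {a \<in> A. B a \<inter> \<Union>\<D> = {}})
      \<le> X / (\<Sum>S\<in>\<D>. \<Prod>p\<in>S. g p / (1 - g p)) + R * (\<Sum>S\<in>\<D>. \<Prod>p\<in>S. 1 / (1 - g p))\<^sup>2"
proof -
  define h where "h S = (\<Prod>p\<in>S. g p / (1 - g p))" for S
  define G where "G = sum h \<D>"
  define l where "l S = (-1) ^ card S / prod g S * ((\<Sum>E | E \<in> \<D> \<and> S \<subseteq> E. h E) / G)" for S
  have gp: "0 < g p" "g p < 1" if "p \<in> S" "S \<in> \<D>" for p S
    using g that by blast+
  have gS: "0 < prod g S" if "S \<in> \<D>" for S
    by (rule prod_pos) (use g that in auto)
  have hS: "0 < h S" if "S \<in> \<D>" for S
    unfolding h_def by (rule prod_pos) (use gp that in simp)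
  have G: "G \<ge> 1"
  proof -
    have "h {} \<le> sum h \<D>"
      by (rule member_le_sum) (use hS empty fin\<D> less_imp_le in auto)
    then show ?thesis by (simp add: h_def G_def)
  qed
  have l0: "l {} = 1"
    using G by (simp add: l_def G_def)
  \<comment> \<open>the sets \<open>E - S\<close> are distinct members of \<open>\<D>\<close>, so the inner sum is at most \<open>h S * G\<close>\<close>
  have labs: "\<bar>l S\<bar> \<le> (\<Prod>p\<in>S. 1 / (1 - g p))" if "S \<in> \<D>" for S
  proof -
    have split: "h E = h S * h (E - S)" if "E \<in> \<D>" "S \<subseteq> E" for E
      unfolding h_def using prod.subset_diff[OF that(2) finS[OF that(1)]] by (simp add: mult.commute)
    have "(\<Sum>E | E \<in> \<D> \<and> S \<subseteq> E. h E) = (\<Sum>E | E \<in> \<D> \<and> S \<subseteq> E. h S * h (E - S))"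
      by (rule sum.cong) (use split in auto)
    also have "\<dots> = h S * (\<Sum>E | E \<in> \<D> \<and> S \<subseteq> E. h (E - S))"
      by (simp add: sum_distrib_left)
    also have "(\<Sum>E | E \<in> \<D> \<and> S \<subseteq> E. h (E - S)) = sum h ((\<lambda>E. E - S) ` {E. E \<in> \<D> \<and> S \<subseteq> E})"
      by (subst sum.reindex) (auto simp: inj_on_def)
    also have "\<dots> \<le> G" unfolding G_def
    proof (rule sum_mono2[OF fin\<D>])
      show "(\<lambda>E. E - S) ` {E \<in> \<D>. S \<subseteq> E} \<subseteq> \<D>" using down by blast
    qed (use hS less_imp_le in blast)
    finally have le: "(\<Sum>E | E \<in> \<D> \<and> S \<subseteq> E. h E) / G \<le> h S"
      using G hS[OF that] by (simp add: divide_le_eq mult_left_mono)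
    have nn: "(\<Sum>E | E \<in> \<D> \<and> S \<subseteq> E. h E) / G \<ge> 0"
      using G hS by (intro divide_nonneg_nonneg sum_nonneg) (auto intro: less_imp_le)
    have "\<bar>l S\<bar> = 1 / prod g S * ((\<Sum>E | E \<in> \<D> \<and> S \<subseteq> E. h E) / G)"
      unfolding l_def abs_mult abs_of_nonneg[OF nn] using gS[OF that] by (simp add: power_abs)
    also have "\<dots> \<le> 1 / prod g S * h S"
      by (rule mult_left_mono[OF le]) (use gS[OF that] in simp)
    also have "\<dots> = (\<Prod>p\<in>S. 1 / g p * (g p / (1 - g p)))"
      by (simp only: h_def prod.distrib prod_dividef[symmetric]) (simp add: prod_dividef)
    also have "\<dots> = (\<Prod>p\<in>S. 1 / (1 - g p))"
      by (rule prod.cong) (use gp[OF _ that] in force)+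
    finally show ?thesis .
  qed
  \<comment> \<open>the diagonal variables at the chosen weights: Moebius inversion of the definition of \<open>l\<close>\<close>
  have z: "(\<Sum>S | S \<in> \<D> \<and> E \<subseteq> S. l S * prod g S) = (-1) ^ card E * h E / G" if E: "E \<in> \<D>" for E
  proof -
    have "(\<Sum>S | S \<in> \<D> \<and> E \<subseteq> S. l S * prod g S)
        = (\<Sum>S | S \<in> \<D> \<and> E \<subseteq> S. \<Sum>F | F \<in> \<D> \<and> S \<subseteq> F. (-1) ^ card S * h F / G)"
    proof (rule sum.cong[OF refl])
      fix S assume "S \<in> {S. S \<in> \<D> \<and> E \<subseteq> S}"
      then have "prod g S \<noteq> 0" using gS by force
      then have "l S * prod g S = (-1) ^ card S * ((\<Sum>F | F \<in> \<D> \<and> S \<subseteq> F. h F) / G)"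
        by (simp add: l_def)
      then show "l S * prod g S = (\<Sum>F | F \<in> \<D> \<and> S \<subseteq> F. (-1) ^ card S * h F / G)"
        by (simp add: sum_distrib_left sum_divide_distrib)
    qed
    also have "\<dots> = (\<Sum>F | F \<in> \<D> \<and> E \<subseteq> F. \<Sum>S | E \<subseteq> S \<and> S \<subseteq> F. (-1) ^ card S * h F / G)"
    proof -
      have "(\<Sum>S | S \<in> \<D> \<and> E \<subseteq> S. \<Sum>F | F \<in> \<D> \<and> S \<subseteq> F. (-1) ^ card S * h F / G)
          = (\<Sum>S | S \<in> \<D> \<and> E \<subseteq> S. \<Sum>F | F \<in> {F. F \<in> \<D> \<and> E \<subseteq> F} \<and> S \<subseteq> F. (-1) ^ card S * h F / G)"
        by (intro sum.cong refl) auto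
      also have "\<dots> = (\<Sum>F | F \<in> \<D> \<and> E \<subseteq> F. \<Sum>S | S \<in> {S. S \<in> \<D> \<and> E \<subseteq> S} \<and> S \<subseteq> F. (-1) ^ card S * h F / G)"
        by (rule sum.swap_restrict) (use fin\<D> in auto)
      also have "\<dots> = (\<Sum>F | F \<in> \<D> \<and> E \<subseteq> F. \<Sum>S | E \<subseteq> S \<and> S \<subseteq> F. (-1) ^ card S * h F / G)"
        by (intro sum.cong refl) (use down in auto)
      finally show ?thesis .
    qed
    also have "\<dots> = (\<Sum>F | F \<in> \<D> \<and> E \<subseteq> F. (if E = F then (-1) ^ card E else 0) * (h F / G))"
    proof (intro sum.cong refl)
      fix F assume "F \<in> {F. F \<in> \<D> \<and> E \<subseteq> F}"
      then have "finite F" "E \<subseteq> F" using finS by auto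
      from sum_between_alternating[OF this]
      show "(\<Sum>S | E \<subseteq> S \<and> S \<subseteq> F. (-1) ^ card S * h F / G)
          = (if E = F then (-1) ^ card E else 0) * (h F / G)"
        by (simp add: sum_distrib_right[symmetric] sum_divide_distrib[symmetric])
    qed
    also have "\<dots> = (\<Sum>F | F \<in> \<D> \<and> E \<subseteq> F. if F = E then (-1) ^ card E * h E / G else 0)"
      by (intro sum.cong refl) auto
    also have "\<dots> = (-1) ^ card E * h E / G"
      using E fin\<D> by simp
    finally show ?thesis .
  qed
  \<comment> \<open>\<open>1 / g = 1 + 1 / h\<close> at each element, expanded over the intersection; this diagonalizes the form\<close>
  have gun: "prod g (S \<union> T) = (\<Sum>E | E \<in> \<D> \<and> E \<subseteq> S \<and> E \<subseteq> T. prod g S * prod g T / h E)"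
    if S: "S \<in> \<D>" and T: "T \<in> \<D>" for S T
  proof -
    have ST: "S \<inter> T \<in> \<D>" by (rule down[OF S]) auto
    have "(\<Sum>E | E \<in> \<D> \<and> E \<subseteq> S \<and> E \<subseteq> T. 1 / h E) = (\<Sum>E\<in>Pow (S \<inter> T). \<Prod>p\<in>E. (1 - g p) / g p)"
      by (intro sum.cong) (use down[OF ST] in \<open>auto simp: h_def prod_dividef\<close>)
    also have "\<dots> = (\<Prod>p\<in>S \<inter> T. 1 + (1 - g p) / g p)"
      using finS[OF S] by (subst sum_Pow_prod) auto
    also have "\<dots> = (\<Prod>p\<in>S \<inter> T. 1 / g p)"
      by (rule prod.cong) (use gp[OF _ S] in \<open>force simp: field_simps\<close>)+
    also have "\<dots> = 1 / prod g (S \<inter> T)"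
      by (simp add: prod_dividef)
    finally have 1: "(\<Sum>E | E \<in> \<D> \<and> E \<subseteq> S \<and> E \<subseteq> T. 1 / h E) = 1 / prod g (S \<inter> T)" .
    have "prod g (S \<union> T) * prod g (S \<inter> T) = prod g S * prod g T"
      by (rule prod.union_inter) (use finS S T in auto)
    then have "prod g (S \<union> T) = prod g S * prod g T * (1 / prod g (S \<inter> T))"
      using gS[OF ST] by (simp add: field_simps)
    then show ?thesis
      unfolding 1[symmetric] by (simp add: sum_distrib_left)
  qed
  have quad: "(\<Sum>S\<in>\<D>. \<Sum>T\<in>\<D>. l S * l T * prod g (S \<union> T)) = 1 / G"
  proof -
    have "(\<Sum>S\<in>\<D>. \<Sum>T\<in>\<D>. l S * l T * prod g (S \<union> T))
        = (\<Sum>S\<in>\<D>. \<Sum>T\<in>\<D>. \<Sum>E\<in>\<D>. if E \<subseteq> S \<and> E \<subseteq> T then (l S * prod g S) * (l T * prod g T) / h E else 0)"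
      by (intro sum.cong refl)
         (auto simp: gun sum_distrib_left sum.inter_filter[OF fin\<D>] mult_ac intro!: sum.cong)
    also have "\<dots> = (\<Sum>S\<in>\<D>. \<Sum>E\<in>\<D>. \<Sum>T\<in>\<D>. if E \<subseteq> S \<and> E \<subseteq> T then (l S * prod g S) * (l T * prod g T) / h E else 0)"
      by (intro sum.cong refl sum.swap)
    also have "\<dots> = (\<Sum>E\<in>\<D>. \<Sum>S\<in>\<D>. \<Sum>T\<in>\<D>. if E \<subseteq> S \<and> E \<subseteq> T then (l S * prod g S) * (l T * prod g T) / h E else 0)"
      by (rule sum.swap)
    also have "\<dots> = (\<Sum>E\<in>\<D>. (\<Sum>S | S \<in> \<D> \<and> E \<subseteq> S. l S * prod g S)\<^sup>2 / h E)"
    proof (rule sum.cong[OF refl])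
      fix E assume "E \<in> \<D>"
      have "(\<Sum>S | S \<in> \<D> \<and> E \<subseteq> S. l S * prod g S)\<^sup>2 / h E
          = (\<Sum>S\<in>\<D>. \<Sum>T\<in>\<D>. (if E \<subseteq> S then l S * prod g S else 0) * (if E \<subseteq> T then l T * prod g T else 0)) / h E"
        by (simp add: sum.inter_filter[OF fin\<D>] power2_eq_square sum_product)
      also have "\<dots> = (\<Sum>S\<in>\<D>. \<Sum>T\<in>\<D>. if E \<subseteq> S \<and> E \<subseteq> T then (l S * prod g S) * (l T * prod g T) / h E else 0)"
        unfolding sum_divide_distrib by (intro sum.cong refl) simp
      finally show "(\<Sum>S\<in>\<D>. \<Sum>T\<in>\<D>. if E \<subseteq> S \<and> E \<subseteq> T then (l S * prod g S) * (l T * prod g T) / h E else 0)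
          = (\<Sum>S | S \<in> \<D> \<and> E \<subseteq> S. l S * prod g S)\<^sup>2 / h E" by simp
    qed
    also have "\<dots> = (\<Sum>E\<in>\<D>. h E / G\<^sup>2)"
    proof (rule sum.cong[OF refl])
      fix E assume E: "E \<in> \<D>"
      show "(\<Sum>S | S \<in> \<D> \<and> E \<subseteq> S. l S * prod g S)\<^sup>2 / h E = h E / G\<^sup>2"
        unfolding z[OF E] using hS[OF E]
        by (simp add: power_divide power_mult_distrib power2_eq_square flip: power_add mult_2)
    qed
    also have "\<dots> = 1 / G"
      using G by (simp add: sum_divide_distrib[symmetric] power2_eq_square flip: G_def)
    finally show ?thesis .
  qed
  have "real (card {a \<in> A. B a \<inter> \<Union>\<D> = {}}) = (\<Sum>a | a \<in> A \<and> B a \<inter> \<Union>\<D> = {}. 1)"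
    by simp
  also have "\<dots> = (\<Sum>a | a \<in> A \<and> B a \<inter> \<Union>\<D> = {}. (\<Sum>S | S \<in> \<D> \<and> S \<subseteq> B a. l S)\<^sup>2)"
  proof (rule sum.cong[OF refl])
    fix a assume "a \<in> {a. a \<in> A \<and> B a \<inter> \<Union>\<D> = {}}"
    then have "{S. S \<in> \<D> \<and> S \<subseteq> B a} = {{}}" using empty by blast
    then show "1 = (\<Sum>S | S \<in> \<D> \<and> S \<subseteq> B a. l S)\<^sup>2" by (simp add: l0)
  qed
  also have "\<dots> \<le> (\<Sum>a\<in>A. (\<Sum>S | S \<in> \<D> \<and> S \<subseteq> B a. l S)\<^sup>2)"
    by (rule sum_mono2[OF finA]) auto
  also have "\<dots> = (\<Sum>a\<in>A. \<Sum>S\<in>\<D>. \<Sum>T\<in>\<D>. l S * l T * (if S \<union> T \<subseteq> B a then 1 else 0))"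
  proof (rule sum.cong[OF refl])
    fix a
    have "(\<Sum>S | S \<in> \<D> \<and> S \<subseteq> B a. l S)\<^sup>2
        = (\<Sum>S\<in>\<D>. \<Sum>T\<in>\<D>. (if S \<subseteq> B a then l S else 0) * (if T \<subseteq> B a then l T else 0))"
      by (simp add: sum.inter_filter[OF fin\<D>] power2_eq_square sum_product)
    also have "\<dots> = (\<Sum>S\<in>\<D>. \<Sum>T\<in>\<D>. l S * l T * (if S \<union> T \<subseteq> B a then 1 else 0))"
      by (intro sum.cong refl) simp
    finally show "(\<Sum>S | S \<in> \<D> \<and> S \<subseteq> B a. l S)\<^sup>2 = \<dots>" .
  qed
  also have "\<dots> = (\<Sum>S\<in>\<D>. \<Sum>T\<in>\<D>. l S * l T * (\<Sum>a\<in>A. if S \<union> T \<subseteq> B a then 1 else 0))"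
    unfolding sum_distrib_left by (subst sum.swap, intro sum.cong refl, rule sum.swap)
  also have "\<dots> = (\<Sum>S\<in>\<D>. \<Sum>T\<in>\<D>. l S * l T * real (card {a \<in> A. S \<union> T \<subseteq> B a}))"
    using finA by (simp add: sum.If_cases Int_def)
  also have "\<dots> \<le> (\<Sum>S\<in>\<D>. \<Sum>T\<in>\<D>. X * (l S * l T * prod g (S \<union> T)) + R * (\<bar>l S\<bar> * \<bar>l T\<bar>))"
  proof (intro sum_mono)
    fix S T assume "S \<in> \<D>" "T \<in> \<D>"
    define e where "e = real (card {a \<in> A. S \<union> T \<subseteq> B a}) - X * prod g (S \<union> T)"
    have "l S * l T * e \<le> \<bar>l S * l T\<bar> * \<bar>e\<bar>" by (metis abs_ge_self abs_mult)
    also have "\<dots> \<le> \<bar>l S * l T\<bar> * R"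
      using R[OF \<open>S \<in> \<D>\<close> \<open>T \<in> \<D>\<close>] by (intro mult_left_mono) (auto simp: e_def)
    finally show "l S * l T * real (card {a \<in> A. S \<union> T \<subseteq> B a})
        \<le> X * (l S * l T * prod g (S \<union> T)) + R * (\<bar>l S\<bar> * \<bar>l T\<bar>)"
      by (simp add: e_def algebra_simps abs_mult)
  qed
  also have "\<dots> = X / G + R * (\<Sum>S\<in>\<D>. \<bar>l S\<bar>)\<^sup>2"
    using quad by (simp add: sum.distrib power2_eq_square sum_product flip: sum_distrib_left)
  also have "\<dots> \<le> X / G + R * (\<Sum>S\<in>\<D>. \<Prod>p\<in>S. 1 / (1 - g p))\<^sup>2"
  proof -
    have "0 \<le> R" using R[OF empty empty] by linarith
    moreover have "(\<Sum>S\<in>\<D>. \<bar>l S\<bar>) \<le> (\<Sum>S\<in>\<D>. \<Prod>p\<in>S. 1 / (1 - g p))"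
      by (rule sum_mono) (rule labs)
    ultimately show ?thesis
      by (intro add_left_mono mult_left_mono power_mono sum_nonneg) auto
  qed
  finally show ?thesis unfolding G_def h_def .
qed

section \<open>Sums over squarefree odd numbers\<close>

text \<open>
  The odd squarefree numbers up to \<open>D\<close>, each encoded by its set of prime factors.
\<close>

definition odd_prime_sets :: "nat \<Rightarrow> nat set set" where
  "odd_prime_sets D = {S. finite S \<and> (\<forall>p\<in>S. prime p \<and> odd p) \<and> \<Prod>S \<le> D}"

lemma prod_prime_set_pos:
  assumes "S \<in> odd_prime_sets D"
  shows "0 < \<Prod>S"
  using assms by (intro prod_pos) (auto simp: odd_prime_sets_def intro: prime_gt_0_nat)

lemma prime_factors_prod_primes:
  fixes S :: "nat set"
  assumes "finite S" "\<forall>p\<in>S. prime p"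
  shows "prime_factors (\<Prod>S) = S"
  using assms
proof (induction S rule: finite_induct)
  case (insert p S)
  have nz: "p \<noteq> 0" "\<Prod>S \<noteq> 0" using insert by (auto simp: prod_zero_iff prime_gt_0_nat)
  have "prime_factors (p * \<Prod>S) = prime_factors p \<union> prime_factors (\<Prod>S)"
    using nz by (rule prime_factors_product)
  with insert show ?case by (simp add: prime_factorization_prime prime_gt_0_nat)
qed auto

lemma odd_prime_sets_subset_Pow: "odd_prime_sets D \<subseteq> Pow {..D}"
proof
  fix S assume S: "S \<in> odd_prime_sets D"
  have "p \<le> D" if "p \<in> S" for p
  proof -
    have "p dvd \<Prod>S" using S that by (intro dvd_prodI) (auto simp: odd_prime_sets_def)
    then have "p \<le> \<Prod>S" using prod_prime_set_pos[OF S] by (rule dvd_imp_le)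
    then show ?thesis using S by (simp add: odd_prime_sets_def)
  qed
  then show "S \<in> Pow {..D}" by auto
qed

lemma finite_odd_prime_sets: "finite (odd_prime_sets D)"
  using odd_prime_sets_subset_Pow by (rule finite_subset) simp

lemma odd_prime_sets_down:
  assumes "S \<in> odd_prime_sets D" "T \<subseteq> S"
  shows "T \<in> odd_prime_sets D"
proof -
  have "\<Prod>T dvd \<Prod>S"
    using assms by (intro prod_dvd_prod_subset) (auto simp: odd_prime_sets_def)
  then have "\<Prod>T \<le> \<Prod>S" using prod_prime_set_pos[OF assms(1)] by (rule dvd_imp_le)
  then show ?thesis using assms finite_subset by (auto simp: odd_prime_sets_def)
qed

lemma odd_prime_sets_Un:
  assumes "S \<in> odd_prime_sets a" "T \<in> odd_prime_sets b"
  shows "S \<union> T \<in> odd_prime_sets (a * b)"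
proof -
  have fin: "finite S" "finite T" using assms by (auto simp: odd_prime_sets_def)
  have "\<Prod>(S \<union> T) * \<Prod>(S \<inter> T) = \<Prod>S * \<Prod>T"
    using fin by (rule prod.union_inter)
  moreover have "\<Prod>(S \<inter> T) \<ge> 1"
    using prod_prime_set_pos[OF odd_prime_sets_down[OF assms(1)], of "S \<inter> T"] by simp
  ultimately have "\<Prod>(S \<union> T) \<le> \<Prod>S * \<Prod>T"
    by (metis mult.right_neutral mult_le_mono2)
  also have "\<dots> \<le> a * b" using assms by (intro mult_mono) (auto simp: odd_prime_sets_def)
  finally show ?thesis using assms by (auto simp: odd_prime_sets_def)
qed

lemma card_odd_prime_sets: "card (odd_prime_sets D) \<le> D"
proof -
  have "inj_on Prod (odd_prime_sets D)"
    by (rule inj_onI) (metis (no_types, lifting) mem_Collect_eq odd_prime_sets_def prime_factors_prod_primes)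
  moreover have "Prod ` odd_prime_sets D \<subseteq> {1..D}"
  proof (rule image_subsetI)
    fix S assume "S \<in> odd_prime_sets D"
    then show "\<Prod>S \<in> {1..D}"
      using prod_prime_set_pos[of S D] by (simp add: odd_prime_sets_def Suc_le_eq)
  qed
  ultimately have "card (odd_prime_sets D) \<le> card {1..D}"
    by (intro card_inj_on_le) auto
  then show ?thesis by simp
qed

text \<open>
  Each \<open>p \<in> U\<close> lies in \<open>S\<close> only, in \<open>T\<close> only, or in both, and so contributes
  \<open>u p + v p + u p * v p\<close>.
\<close>

lemma sum_prod_union_eq:
  fixes u v :: "'p \<Rightarrow> real"
  assumes "finite U"
  shows "(\<Sum>(S, T) | S \<union> T = U. prod u S * prod v T) = (\<Prod>p\<in>U. (1 + u p) * (1 + v p) - 1)"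
proof -
  have "bij_betw (\<lambda>(S, V). (S, (U - S) \<union> V)) (SIGMA S:Pow U. Pow S) {(S, T). S \<union> T = U}"
    by (rule bij_betwI[where g = "\<lambda>(S, T). (S, S \<inter> T)"]) auto
  then have "(\<Sum>(S, T) | S \<union> T = U. prod u S * prod v T)
      = (\<Sum>(S, V)\<in>(SIGMA S:Pow U. Pow S). prod u S * prod v ((U - S) \<union> V))"
    by (subst sum.reindex_bij_betw[symmetric, where h = "\<lambda>(S, V). (S, (U - S) \<union> V)"])
       (simp_all add: case_prod_unfold)
  also have "\<dots> = (\<Sum>S\<in>Pow U. \<Sum>V\<in>Pow S. prod u S * prod v ((U - S) \<union> V))"
    using assms by (subst sum.Sigma) (auto intro: finite_subset)
  also have "\<dots> = (\<Sum>S\<in>Pow U. (\<Prod>p\<in>S. u p * (1 + v p)) * prod v (U - S))"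
  proof (rule sum.cong[OF refl])
    fix S assume S: "S \<in> Pow U"
    then have fin: "finite S" using assms finite_subset by auto
    have "(\<Sum>V\<in>Pow S. prod u S * prod v ((U - S) \<union> V)) = (\<Sum>V\<in>Pow S. prod u S * prod v (U - S) * prod v V)"
    proof (rule sum.cong[OF refl])
      fix V assume V: "V \<in> Pow S"
      have "prod v ((U - S) \<union> V) = prod v (U - S) * prod v V"
        using V assms fin finite_subset by (intro prod.union_disjoint) auto
      then show "prod u S * prod v ((U - S) \<union> V) = prod u S * prod v (U - S) * prod v V" by simp
    qed
    also have "\<dots> = (\<Prod>p\<in>S. u p * (1 + v p)) * prod v (U - S)"
      using sum_Pow_prod[OF fin, of v]
      by (simp add: sum_distrib_left[symmetric] prod.distrib)
    finally show "(\<Sum>V\<in>Pow S. prod u S * prod v ((U - S) \<union> V))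
        = (\<Prod>p\<in>S. u p * (1 + v p)) * prod v (U - S)" .
  qed
  also have "\<dots> = (\<Prod>p\<in>U. u p * (1 + v p) + v p)"
    by (rule prod_add[OF assms, symmetric])
  also have "\<dots> = (\<Prod>p\<in>U. (1 + u p) * (1 + v p) - 1)"
    by (rule prod.cong) (simp_all add: algebra_simps)
  finally show ?thesis .
qed

text \<open>
  The product is a sum over pairs \<open>(S, T)\<close>, which are grouped by their union \<open>U\<close>; the pairs with
  union \<open>U\<close> that fail the size conditions contribute nonnegative terms.
\<close>

lemma sum_odd_prime_sets_mult_le:
  fixes u v :: "nat \<Rightarrow> real"
  assumes "\<And>p. u p \<ge> 0" "\<And>p. v p \<ge> 0"
  shows "(\<Sum>S\<in>odd_prime_sets a. prod u S) * (\<Sum>T\<in>odd_prime_sets b. prod v T)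
      \<le> (\<Sum>U\<in>odd_prime_sets (a * b). \<Prod>p\<in>U. (1 + u p) * (1 + v p) - 1)"
proof -
  define Q where "Q = odd_prime_sets a \<times> odd_prime_sets b"
  have fQ: "finite Q" by (simp add: Q_def finite_odd_prime_sets)
  have "(\<Sum>S\<in>odd_prime_sets a. prod u S) * (\<Sum>T\<in>odd_prime_sets b. prod v T)
      = (\<Sum>(S, T)\<in>Q. prod u S * prod v T)"
    by (simp add: sum_product sum.cartesian_product Q_def)
  also have "\<dots> = (\<Sum>U\<in>odd_prime_sets (a * b). \<Sum>(S, T) | (S, T) \<in> Q \<and> S \<union> T = U. prod u S * prod v T)"
    by (subst sum.group[of Q "odd_prime_sets (a * b)" "\<lambda>(S, T). S \<union> T", symmetric])
       (auto simp: fQ finite_odd_prime_sets Q_def odd_prime_sets_Un intro!: sum.cong)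
  also have "\<dots> \<le> (\<Sum>U\<in>odd_prime_sets (a * b). \<Sum>(S, T) | S \<union> T = U. prod u S * prod v T)"
  proof (intro sum_mono sum_mono2)
    fix U assume "U \<in> odd_prime_sets (a * b)"
    then have "finite U" by (simp add: odd_prime_sets_def)
    moreover have "{(S, T). S \<union> T = U} \<subseteq> Pow U \<times> Pow U" by auto
    ultimately show "finite {(S, T). S \<union> T = U}" by (meson finite_Pow_iff finite_SigmaI finite_subset)
  qed (use assms in \<open>auto intro!: mult_nonneg_nonneg prod_nonneg\<close>)
  also have "\<dots> = (\<Sum>U\<in>odd_prime_sets (a * b). \<Prod>p\<in>U. (1 + u p) * (1 + v p) - 1)"
    by (intro sum.cong refl sum_prod_union_eq) (simp add: odd_prime_sets_def)
  finally show ?thesis .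
qed

text \<open>
  A substitute for the asymptotics of divisor sums: the right-hand side is a lower bound for the
  denominator in Selberg's sieve, because \<open>(1 + 1 / p) ^ 4 - 1\<close> is at most the local weight
  \<open>g / (1 - g)\<close> of the four forms sieved below.
\<close>

lemma sum_odd_prime_sets_inverse_power4:
  "(\<Sum>S\<in>odd_prime_sets y. \<Prod>p\<in>S. 1 / real p) ^ 4
    \<le> (\<Sum>U\<in>odd_prime_sets (y ^ 4). \<Prod>p\<in>U. (1 + 1 / real p) ^ 4 - 1)"
proof -
  define H where "H = (\<Sum>S\<in>odd_prime_sets y. \<Prod>p\<in>S. 1 / real p)"
  define H2 where "H2 = (\<Sum>S\<in>odd_prime_sets (y * y). \<Prod>p\<in>S. (1 + 1 / real p) * (1 + 1 / real p) - 1)"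
  have "H \<ge> 0" unfolding H_def by (intro sum_nonneg prod_nonneg) auto
  have "H * H \<le> H2" unfolding H_def H2_def
    by (rule sum_odd_prime_sets_mult_le) auto
  then have "(H * H) * (H * H) \<le> H2 * H2"
    using \<open>H \<ge> 0\<close> by (intro mult_mono) (auto intro: order_trans[of 0 "H * H"])
  also have "\<dots> \<le> (\<Sum>U\<in>odd_prime_sets ((y * y) * (y * y)). \<Prod>p\<in>U.
      (1 + ((1 + 1 / real p) * (1 + 1 / real p) - 1)) * (1 + ((1 + 1 / real p) * (1 + 1 / real p) - 1)) - 1)"
    unfolding H2_def by (rule sum_odd_prime_sets_mult_le) (simp_all add: algebra_simps)
  also have "(y * y) * (y * y) = y ^ 4" by (simp add: power4_eq_xxxx)
  finally show ?thesis
    unfolding H_def[symmetric] by (simp add: power4_eq_xxxx mult.assoc)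
qed

lemma sum_inverse_squares_le_2: "(\<Sum>r = 1..n. 1 / (real r)\<^sup>2) \<le> 2"
proof -
  have "(\<Sum>r = 1..n. 1 / (real r)\<^sup>2) \<le> 2 - 1 / real n" if "n \<ge> 1" for n
    using that
  proof (induction n rule: nat_induct_at_least)
    case (Suc n)
    have "1 / (real (Suc n))\<^sup>2 \<le> 1 / real n - 1 / real (Suc n)"
    proof -
      have "1 / (real (Suc n))\<^sup>2 \<le> 1 / (real n * real (Suc n))"
        using Suc.hyps by (intro divide_left_mono) (auto simp: power2_eq_square)
      also have "\<dots> = 1 / real n - 1 / real (Suc n)"
        using Suc.hyps by (simp add: divide_simps)
      finally show ?thesis .
    qed
    with Suc.IH show ?case by simp
  qed simp
  note le = this
  show ?thesis
  proof (cases "n \<ge> 1")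
    case True
    then have "0 \<le> 1 / real n" by simp
    with le[OF True] show ?thesis by linarith
  qed simp
qed

text \<open>
  Every even \<open>n\<close> is preceded by the odd number \<open>n - 1\<close>, so the odd terms make up at least half of
  the harmonic sum.
\<close>

lemma ln_le_sum_inverse_odd: "ln (real y + 1) / 2 \<le> (\<Sum>n | n \<in> {1..y} \<and> odd n. 1 / real n)"
proof -
  have "(\<Sum>n | n \<in> {1..y} \<and> even n. 1 / real n) \<le> (\<Sum>n | n \<in> {1..y} \<and> even n. 1 / real (n - 1))"
    by (intro sum_mono divide_left_mono) (auto elim!: evenE)
  also have "\<dots> = (\<Sum>n\<in>(\<lambda>n. n - 1) ` {n \<in> {1..y}. even n}. 1 / real n)"
    by (subst sum.reindex) (auto simp: inj_on_def)
  also have "\<dots> \<le> (\<Sum>n | n \<in> {1..y} \<and> odd n. 1 / real n)"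
  proof (rule sum_mono2)
    show "(\<lambda>n. n - 1) ` {n \<in> {1..y}. even n} \<subseteq> {n. n \<in> {1..y} \<and> odd n}"
    proof (safe, goal_cases)
      case (1 _ n)
      then have "n \<ge> 2" by (cases "n = 1") auto
      with 1 show ?case by auto
    next
      case (2 _ n)
      then have "n \<ge> 2" by (cases "n = 1") auto
      with 2 show ?case by simp
    qed
  qed auto
  finally have "(\<Sum>n | n \<in> {1..y} \<and> even n. 1 / real n) \<le> (\<Sum>n | n \<in> {1..y} \<and> odd n. 1 / real n)" .
  moreover have "(\<Sum>n = 1..y. 1 / real n)
      = (\<Sum>n | n \<in> {1..y} \<and> even n. 1 / real n) + (\<Sum>n | n \<in> {1..y} \<and> odd n. 1 / real n)"
    by (subst sum.union_disjoint[symmetric]) (auto intro!: sum.cong)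
  moreover have "ln (real y + 1) \<le> (\<Sum>n = 1..y. 1 / real n)"
    using ln_le_harm[of y] by (simp add: harm_def inverse_eq_divide)
  ultimately show ?thesis by linarith
qed

text \<open>
  Every odd \<open>n \<le> y\<close> is \<open>s * r\<^sup>2\<close> with \<open>s\<close> squarefree, so the sum of \<open>1 / n\<close> is at most the
  sum over \<open>s\<close> times \<open>\<Sum> 1 / r\<^sup>2 \<le> 2\<close>.
\<close>

lemma sum_odd_prime_sets_inverse_ge: "ln (real y + 1) / 4 \<le> (\<Sum>S\<in>odd_prime_sets y. \<Prod>p\<in>S. 1 / real p)"
proof -
  define H where "H = (\<Sum>S\<in>odd_prime_sets y. \<Prod>p\<in>S. 1 / real p)"
  have H0: "H \<ge> 0" unfolding H_def by (intro sum_nonneg prod_nonneg) auto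
  define N where "N = {n. n \<in> {1..y} \<and> odd n}"
  \<comment> \<open>encodes \<open>n = s * r\<^sup>2\<close> by the prime factors of \<open>s\<close> and by \<open>r\<close>\<close>
  define \<phi> :: "nat \<Rightarrow> nat set \<times> nat" where "\<phi> n = (prime_factors (squarefree_part n), square_part n)" for n
  have sqf: "\<Prod>(prime_factors (squarefree_part n)) = squarefree_part n" for n :: nat
  proof -
    have "(\<Prod>p\<in>prime_factors (squarefree_part n). p)
        = (\<Prod>p\<in>prime_factors (squarefree_part n). p ^ multiplicity p (squarefree_part n))"
    proof (rule prod.cong[OF refl])
      fix p assume p: "p \<in> prime_factors (squarefree_part n)"
      then have "multiplicity p (squarefree_part n) \<ge> 1"
        by (simp add: prime_factors_multiplicity Suc_le_eq)
      moreover have "multiplicity p (squarefree_part n) \<le> Suc 0"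
        using p by (intro prime_multiplicity_squarefree_part_le_Suc_0) auto
      ultimately have "multiplicity p (squarefree_part n) = 1" by simp
      then show "p = p ^ multiplicity p (squarefree_part n)" by simp
    qed
    also have "\<dots> = squarefree_part n"
      by (rule prime_factorization_nat[symmetric]) (simp add: zero_less_iff_neq_zero)
    finally show ?thesis by simp
  qed
  have dec: "\<Prod>(fst (\<phi> n)) * (snd (\<phi> n))\<^sup>2 = n" for n
    by (simp add: \<phi>_def sqf flip: squarefree_decompose)
  have "inj_on \<phi> N" using dec by (metis inj_onI)
  have sub: "\<phi> ` N \<subseteq> odd_prime_sets y \<times> {1..y}"
  proof (safe, goal_cases)
    case (1 S r n)
    then have n: "1 \<le> n" "n \<le> y" "odd n" by (auto simp: N_def)
    have nn: "n = \<Prod>S * r\<^sup>2" using dec[of n] 1(1)[symmetric] by simp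
    have "S = prime_factors (squarefree_part n)" using 1 by (simp add: \<phi>_def)
    moreover have "r > 0" using nn n by (cases r) auto
    then have "\<Prod>S \<le> n" by (subst nn) simp
    moreover have "odd p" if "p \<in> S" for p
    proof -
      have "p dvd squarefree_part n" using that \<open>S = _\<close> by auto
      then have "p dvd n" by (subst squarefree_decompose) (rule dvd_mult2)
      with n show ?thesis by (meson dvd_trans)
    qed
    ultimately show ?case using n by (auto simp: odd_prime_sets_def)
  next
    case (2 S r n)
    then have n: "1 \<le> n" "n \<le> y" "odd n" by (auto simp: N_def)
    have nn: "n = \<Prod>S * r\<^sup>2" using dec[of n] 2(1)[symmetric] by simp
    have "r \<noteq> 0" using nn n by auto
    moreover have "r \<le> n"
    proof (rule dvd_imp_le)
      show "r dvd n" by (subst nn) (simp add: power2_eq_square)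
    qed (use n in simp)
    ultimately show ?case using n by simp
  qed
  have "ln (real y + 1) / 2 \<le> (\<Sum>n\<in>N. 1 / real n)"
    unfolding N_def by (rule ln_le_sum_inverse_odd)
  also have "\<dots> = (\<Sum>n\<in>N. (\<lambda>(S, r). (\<Prod>p\<in>S. 1 / real p) * (1 / (real r)\<^sup>2)) (\<phi> n))"
  proof (rule sum.cong[OF refl])
    fix n
    have "real n = (\<Prod>p\<in>fst (\<phi> n). real p) * (real (snd (\<phi> n)))\<^sup>2"
      using arg_cong[OF dec[of n], of real] by simp
    then show "1 / real n = (\<lambda>(S, r). (\<Prod>p\<in>S. 1 / real p) * (1 / (real r)\<^sup>2)) (\<phi> n)"
      by (simp add: case_prod_unfold prod_dividef)
  qed
  also have "\<dots> = (\<Sum>(S, r)\<in>\<phi> ` N. (\<Prod>p\<in>S. 1 / real p) * (1 / (real r)\<^sup>2))"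
    by (subst sum.reindex[OF \<open>inj_on \<phi> N\<close>]) simp
  also have "\<dots> \<le> (\<Sum>(S, r)\<in>odd_prime_sets y \<times> {1..y}. (\<Prod>p\<in>S. 1 / real p) * (1 / (real r)\<^sup>2))"
    using sub by (intro sum_mono2)
      (auto simp: finite_odd_prime_sets intro!: divide_nonneg_nonneg prod_nonneg)
  also have "\<dots> = H * (\<Sum>r = 1..y. 1 / (real r)\<^sup>2)"
    unfolding H_def by (simp only: sum_product sum.cartesian_product)
  also have "\<dots> \<le> H * 2"
    by (intro mult_left_mono sum_inverse_squares_le_2 H0)
  finally show ?thesis unfolding H_def by simp
qed

section \<open>Equidistribution in a square and local densities\<close>

text \<open>
  Full periods contribute their exact share; only an incomplete last period of length below \<open>d\<close>
  causes an error.
\<close>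

lemma sum_periodic:
  fixes f :: "nat \<Rightarrow> real"
  assumes d: "d > 0" and per: "\<And>k. f (k + d) = f k" and f: "\<And>k. 0 \<le> f k" "\<And>k. f k \<le> c"
  shows "\<bar>(\<Sum>k<N. f k) - real N / real d * (\<Sum>k<d. f k)\<bar> \<le> c * real d"
proof (induction N rule: less_induct)
  case (less N)
  show ?case
  proof (cases "N < d")
    case True
    have c: "0 \<le> c" using f order_trans by blast
    have bd: "0 \<le> (\<Sum>k<n. f k)" "(\<Sum>k<n. f k) \<le> c * real n" for n
      using f sum_bounded_above[of "{..<n}" f c] by (auto intro: sum_nonneg simp: mult.commute)
    have "real N / real d * (\<Sum>k<d. f k) \<le> real N / real d * (c * real d)"
      by (intro mult_left_mono bd) auto
    then have "real N / real d * (\<Sum>k<d. f k) \<le> c * real N" using d by (simp add: mult.commute)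
    moreover have "0 \<le> real N / real d * (\<Sum>k<d. f k)" using bd by simp
    moreover have "c * real N \<le> c * real d" using True c by (intro mult_left_mono) auto
    ultimately show ?thesis using bd[of N] by linarith
  next
    case False
    then obtain M where M: "N = M + d" by (metis add.commute le_Suc_ex not_less)
    have "{..<N} = {..<d} \<union> (\<lambda>k. k + d) ` {..<M}"
    proof (intro equalityI subsetI)
      fix k assume "k \<in> {..<N}"
      then show "k \<in> {..<d} \<union> (\<lambda>k. k + d) ` {..<M}"
        by (cases "k < d") (auto simp: M intro!: image_eqI[of _ _ "k - d"])
    qed (auto simp: M)
    moreover have "{..<d} \<inter> (\<lambda>k. k + d) ` {..<M} = {}" by auto
    ultimately have "(\<Sum>k<N. f k) = (\<Sum>k<d. f k) + (\<Sum>k\<in>(\<lambda>k. k + d) ` {..<M}. f k)"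
      by (metis finite_imageI finite_lessThan sum.union_disjoint)
    also have "(\<Sum>k\<in>(\<lambda>k. k + d) ` {..<M}. f k) = (\<Sum>k<M. f k)"
      by (subst sum.reindex) (auto simp: per)
    finally have "(\<Sum>k<N. f k) - real N / real d * (\<Sum>k<d. f k)
        = (\<Sum>k<M. f k) - real M / real d * (\<Sum>k<d. f k)"
      using d by (simp add: M field_simps)
    then show ?thesis using less.IH[of M] M d by simp
  qed
qed

lemma sum_periodic_square:
  fixes f :: "nat \<Rightarrow> nat \<Rightarrow> real"
  assumes d: "d > 0" and per: "\<And>n m. f (n + d) m = f n m" "\<And>n m. f n (m + d) = f n m"
    and f: "\<And>n m. 0 \<le> f n m" "\<And>n m. f n m \<le> 1"
  shows "\<bar>(\<Sum>n<N. \<Sum>m<N. f n m) - (real N)\<^sup>2 * ((\<Sum>n<d. \<Sum>m<d. f n m) / (real d)\<^sup>2)\<bar> \<le> 2 * real N * real d"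
proof -
  define c where "c n = (\<Sum>m<d. f n m)" for n
  have c: "0 \<le> c n" "c n \<le> real d" for n
    using f sum_bounded_above[of "{..<d}" "f n" 1] by (auto simp: c_def intro: sum_nonneg)
  have 1: "\<bar>(\<Sum>m<N. f n m) - real N / real d * c n\<bar> \<le> real d" for n
    unfolding c_def using sum_periodic[OF d, of "f n" 1 N] per f by simp
  have 2: "\<bar>(\<Sum>n<N. c n) - real N / real d * (\<Sum>n<d. c n)\<bar> \<le> real d * real d"
    by (rule sum_periodic[OF d]) (use c in \<open>auto simp: c_def per\<close>)
  have "\<bar>(\<Sum>n<N. \<Sum>m<N. f n m) - real N / real d * (\<Sum>n<N. c n)\<bar>
      = \<bar>\<Sum>n<N. (\<Sum>m<N. f n m) - real N / real d * c n\<bar>"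
    by (simp add: sum_subtractf sum_distrib_left)
  also have "\<dots> \<le> (\<Sum>n<N. \<bar>(\<Sum>m<N. f n m) - real N / real d * c n\<bar>)" by (rule sum_abs)
  also have "\<dots> \<le> (\<Sum>n<N. real d)" by (intro sum_mono 1)
  finally have 3: "\<bar>(\<Sum>n<N. \<Sum>m<N. f n m) - real N / real d * (\<Sum>n<N. c n)\<bar> \<le> real N * real d" by simp
  have "\<bar>real N / real d * ((\<Sum>n<N. c n) - real N / real d * (\<Sum>n<d. c n))\<bar> \<le> real N / real d * (real d * real d)"
    unfolding abs_mult using 2 by (intro mult_mono) auto
  then have 4: "\<bar>real N / real d * (\<Sum>n<N. c n) - (real N)\<^sup>2 * ((\<Sum>n<d. c n) / (real d)\<^sup>2)\<bar> \<le> real N * real d"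
    using d by (simp add: field_simps power2_eq_square)
  have "\<bar>x - z\<bar> \<le> 2 * real N * real d"
    if "\<bar>x - y\<bar> \<le> real N * real d" "\<bar>y - z\<bar> \<le> real N * real d" for x y z
    using abs_triangle_ineq[of "x - y" "y - z"] that by simp
  from this[OF 3 4] show ?thesis unfolding c_def .
qed

text \<open>
  The Chinese remainder theorem as a reindexing of sums.
\<close>

lemma sum_chinese_remainder:
  fixes \<phi> :: "nat \<Rightarrow> nat \<Rightarrow> real"
  assumes "coprime a b"
  shows "(\<Sum>n<a * b. \<phi> (n mod a) (n mod b)) = (\<Sum>i<a. \<Sum>j<b. \<phi> i j)"
proof (cases "a = 0 \<or> b = 0")
  case False
  define \<psi> where "\<psi> n = (n mod a, n mod b)" for n
  have inj: "inj_on \<psi> {..<a * b}"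
  proof (rule inj_onI)
    fix x y assume xy: "x \<in> {..<a * b}" "y \<in> {..<a * b}" "\<psi> x = \<psi> y"
    then have "[x = y] (mod a)" "[x = y] (mod b)" by (auto simp: \<psi>_def cong_def)
    then have "[x = y] (mod a * b)" using assms by (rule coprime_cong_mult_nat)
    with xy show "x = y" by (auto simp: cong_def)
  qed
  have "\<psi> ` {..<a * b} = {..<a} \<times> {..<b}"
  proof (rule card_subset_eq)
    show "card (\<psi> ` {..<a * b}) = card ({..<a} \<times> {..<b})"
      unfolding card_image[OF inj] by simp
  qed (use False in \<open>auto simp: \<psi>_def\<close>)
  then have "(\<Sum>n<a * b. case \<psi> n of (i, j) \<Rightarrow> \<phi> i j) = (\<Sum>(i, j)\<in>{..<a} \<times> {..<b}. \<phi> i j)"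
    using sum.reindex[OF inj, of "\<lambda>(i, j). \<phi> i j"] by simp
  then show ?thesis by (simp add: \<psi>_def sum.cartesian_product)
qed auto

lemma periodic_mod:
  fixes f :: "nat \<Rightarrow> 'a"
  assumes "\<And>n. f (n + d) = f n"
  shows "f (n mod d) = f n"
proof -
  have "f (k + q * d) = f k" for k q
  proof (induction q)
    case (Suc q)
    then show ?case using assms[of "k + q * d"] by (simp add: algebra_simps)
  qed simp
  from this[of "n mod d" "n div d"] show ?thesis by simp
qed

lemma sum_square_chinese_remainder:
  fixes f g :: "nat \<Rightarrow> nat \<Rightarrow> real"
  assumes "coprime a b"
    and f: "\<And>n m. f (n + a) m = f n m" "\<And>n m. f n (m + a) = f n m"
    and g: "\<And>n m. g (n + b) m = g n m" "\<And>n m. g n (m + b) = g n m"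
  shows "(\<Sum>n<a * b. \<Sum>m<a * b. f n m * g n m)
    = (\<Sum>n<a. \<Sum>m<a. f n m) * (\<Sum>n<b. \<Sum>m<b. g n m)"
proof -
  have fm: "f (n mod a) m = f n m" "f n (m mod a) = f n m" for n m
    using periodic_mod[of "\<lambda>n. f n m" a n] periodic_mod[of "f n" a m] f by auto
  have gm: "g (n mod b) m = g n m" "g n (m mod b) = g n m" for n m
    using periodic_mod[of "\<lambda>n. g n m" b n] periodic_mod[of "g n" b m] g by auto
  have inner: "(\<Sum>m<a * b. f n m * g n m) = (\<Sum>k<a. f n k) * (\<Sum>l<b. g n l)" for n
    using sum_chinese_remainder[OF assms(1), of "\<lambda>k l. f n k * g n l"]
    by (simp add: fm gm sum_product)
  have "(\<Sum>n<a * b. \<Sum>m<a * b. f n m * g n m) = (\<Sum>i<a. \<Sum>j<b. (\<Sum>k<a. f i k) * (\<Sum>l<b. g j l))"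
    using sum_chinese_remainder[OF assms(1), of "\<lambda>i j. (\<Sum>k<a. f i k) * (\<Sum>l<b. g j l)"]
    by (simp add: inner fm gm)
  then show ?thesis by (simp add: sum_product)
qed

lemma periodic_prod:
  fixes f :: "nat \<Rightarrow> nat \<Rightarrow> real"
  assumes "finite S" "\<And>p n. p \<in> S \<Longrightarrow> f p (n + p) = f p n"
  shows "(\<Prod>p\<in>S. f p (n + \<Prod>S)) = (\<Prod>p\<in>S. f p n)"
proof (rule prod.cong[OF refl])
  fix p assume p: "p \<in> S"
  then have "p dvd \<Prod>S" using assms(1) by (intro dvd_prodI)
  then have "(n + \<Prod>S) mod p = n mod p" by auto
  moreover have "f p (k mod p) = f p k" for k
    by (rule periodic_mod) (rule assms(2)[OF p])
  ultimately show "f p (n + \<Prod>S) = f p n" by metis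
qed

text \<open>
  Local densities are independent at distinct primes. This is what makes the density of the pairs
  \<open>(n, m)\<close> at which all primes in \<open>S\<close> divide a polynomial value a product over \<open>S\<close>.
\<close>

lemma sum_square_prod_periodic:
  fixes f :: "nat \<Rightarrow> nat \<Rightarrow> nat \<Rightarrow> real"
  assumes "finite S" "\<And>p. p \<in> S \<Longrightarrow> prime p"
    and "\<And>p n m. p \<in> S \<Longrightarrow> f p (n + p) m = f p n m" "\<And>p n m. p \<in> S \<Longrightarrow> f p n (m + p) = f p n m"
  shows "(\<Sum>n<\<Prod>S. \<Sum>m<\<Prod>S. \<Prod>p\<in>S. f p n m) = (\<Prod>p\<in>S. \<Sum>n<p. \<Sum>m<p. f p n m)"
  using assms
proof (induction S rule: finite_induct)
  case (insert q S)
  have "coprime q (\<Prod>S)"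
    by (rule prod_coprime_right) (use insert in \<open>auto intro: primes_coprime\<close>)
  then have "(\<Sum>n<q * \<Prod>S. \<Sum>m<q * \<Prod>S. f q n m * (\<Prod>p\<in>S. f p n m))
      = (\<Sum>n<q. \<Sum>m<q. f q n m) * (\<Sum>n<\<Prod>S. \<Sum>m<\<Prod>S. \<Prod>p\<in>S. f p n m)"
  proof (rule sum_square_chinese_remainder)
    show "(\<Prod>p\<in>S. f p (n + \<Prod>S) m) = (\<Prod>p\<in>S. f p n m)" for n m
      using periodic_prod[of S "\<lambda>p n. f p n m"] insert by simp
    show "(\<Prod>p\<in>S. f p n (m + \<Prod>S)) = (\<Prod>p\<in>S. f p n m)" for n m
      using periodic_prod[of S "\<lambda>p. f p n"] insert by simp
  qed (use insert in auto)
  then show ?case using insert by simp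
qed simp

text \<open>
  With \<open>n\<close> and \<open>int n + t - int m\<close> standing for the primes \<open>p\<close> and \<open>p'\<close> in \<open>p + t = p' + m\<close>, all
  four factors are prime if \<open>m\<close> is the smaller member of a twin pair.
\<close>

definition twin_form :: "int \<Rightarrow> nat \<Rightarrow> nat \<Rightarrow> int" where
  "twin_form t n m = int n * (int n + t - int m) * int m * (int m + 2)"

lemma twin_form_periodic:
  "int p dvd twin_form t (n + p) m \<longleftrightarrow> int p dvd twin_form t n m"
  "int p dvd twin_form t n (m + p) \<longleftrightarrow> int p dvd twin_form t n m"
proof -
  have "[twin_form t (n + p) m = twin_form t n m] (mod int p)"
    unfolding twin_form_def by (intro cong_mult cong_add cong_diff cong_refl) (auto simp: cong_def)
  then show "int p dvd twin_form t (n + p) m \<longleftrightarrow> int p dvd twin_form t n m" by (rule cong_dvd_iff)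
  have "[twin_form t n (m + p) = twin_form t n m] (mod int p)"
    unfolding twin_form_def by (intro cong_mult cong_add cong_diff cong_refl) (auto simp: cong_def)
  then show "int p dvd twin_form t n (m + p) \<longleftrightarrow> int p dvd twin_form t n m" by (rule cong_dvd_iff)
qed

definition local_survivors :: "int \<Rightarrow> nat \<Rightarrow> nat" where
  "local_survivors t p = card {(n, m). n < p \<and> m < p \<and> \<not> int p dvd twin_form t n m}"

text \<open>
  There are \<open>p - 2\<close> residues \<open>m\<close> other than \<open>0\<close> and \<open>-2\<close>. For each of them \<open>n\<close> has to avoid \<open>0\<close> and
  \<open>m - t\<close>, which are two different residues unless \<open>m\<close> is congruent to \<open>t\<close>. So the shift \<open>t\<close>
  influences the count by at most one, and the sieve bound becomes uniform in \<open>t\<close>.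
\<close>

lemma local_survivors_eq:
  assumes p: "prime p" "odd p"
  shows "\<exists>e\<in>{0, 1}. local_survivors t p = (p - 2)\<^sup>2 + e"
proof -
  have p3: "p \<ge> 3" using prime_ge_2_nat[OF p(1)] p(2) by (cases "p = 2") auto
  define M where "M = {..<p} - {0, p - 2}"
  define r where "r m = nat ((int m - t) mod int p)" for m
  have M: "m < p \<and> \<not> int p dvd int m * (int m + 2) \<longleftrightarrow> m \<in> M" for m
  proof -
    have "int p dvd int m * (int m + 2) \<longleftrightarrow> p dvd m \<or> p dvd m + 2"
    proof -
      have "int m * (int m + 2) = int (m * (m + 2))" by (simp add: algebra_simps)
      then show ?thesis using prime_dvd_mult_iff[OF p(1)] by (metis int_dvd_int_iff)
    qed
    moreover have "p dvd m \<longleftrightarrow> m = 0" if "m < p" using that nat_dvd_not_less by auto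
    moreover have "p dvd m + 2 \<longleftrightarrow> m = p - 2" if "m < p"
    proof
      assume "p dvd m + 2"
      then obtain k where k: "m + 2 = p * k" by (auto elim: dvdE)
      have "k < 2"
      proof (rule ccontr)
        assume "\<not> k < 2"
        then have "p * 2 \<le> p * k" by simp
        with k that p3 show False by linarith
      qed
      moreover have "k \<noteq> 0" using k by (cases k) auto
      ultimately have "k = 1" by simp
      with k show "m = p - 2" by simp
    next
      assume "m = p - 2"
      then have "m + 2 = p" using p3 by simp
      then show "p dvd m + 2" by simp
    qed
    ultimately show ?thesis by (auto simp: M_def)
  qed
  have r: "int (r m) = (int m - t) mod int p" for m
    using p3 by (simp add: r_def)
  have rp: "r m < p" for m
    using r[of m] pos_mod_bound[of "int p" "int m - t"] p3 by linarith
  have inner: "{n. n < p \<and> \<not> int p dvd int n * (int n + t - int m)} = {..<p} - {0, r m}" for m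
  proof -
    have "int p dvd int n * (int n + t - int m) \<longleftrightarrow> n = 0 \<or> n = r m" if "n < p" for n
    proof -
      have "int p dvd int n * (int n + t - int m) \<longleftrightarrow> int p dvd int n \<or> int p dvd int n + t - int m"
        using p by (simp add: prime_dvd_mult_iff)
      moreover have "int p dvd int n \<longleftrightarrow> n = 0" using that nat_dvd_not_less by auto
      moreover have "int p dvd int n + t - int m \<longleftrightarrow> int n mod int p = (int m - t) mod int p"
        by (simp add: mod_eq_dvd_iff algebra_simps)
      moreover have "int n mod int p = int n" using that by simp
      ultimately show ?thesis using r[of m] by auto
    qed
    then show ?thesis by auto
  qed
  have r0: "r m = 0 \<longleftrightarrow> m = nat (t mod int p)" if "m < p" for m
  proof -
    have "r m = 0 \<longleftrightarrow> int (r m) = 0" by simp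
    also have "\<dots> \<longleftrightarrow> int m mod int p = t mod int p"
      unfolding r by (simp add: mod_eq_dvd_iff dvd_eq_mod_eq_0)
    also have "int m mod int p = int m" using that by simp
    also have "int m = t mod int p \<longleftrightarrow> m = nat (t mod int p)"
      using pos_mod_sign[of "int p" t] p3 by auto
    finally show ?thesis .
  qed
  have cinner: "card ({..<p} - {0, r m}) = p - 2 + (if m = nat (t mod int p) then 1 else 0)" if "m < p" for m
  proof (cases "r m = 0")
    case True
    then show ?thesis using p3 r0[OF that] by (simp add: card_Diff_subset)
  next
    case False
    then have "card ({..<p} - {0, r m}) = card {..<p} - card {0, r m}"
      using rp p3 by (intro card_Diff_subset) auto
    then show ?thesis using False r0[OF that] by simp
  qed
  have "{(n, m). n < p \<and> m < p \<and> \<not> int p dvd twin_form t n m}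
      = prod.swap ` (SIGMA m:M. {n. n < p \<and> \<not> int p dvd int n * (int n + t - int m)})"
  proof -
    have "int p dvd twin_form t n m \<longleftrightarrow>
        int p dvd int n * (int n + t - int m) \<or> int p dvd int m * (int m + 2)" for n m
      using p by (simp add: twin_form_def prime_dvd_mult_iff mult.assoc disj_assoc)
    then show ?thesis by (auto simp: image_iff simp flip: M)
  qed
  then have "local_survivors t p = card (SIGMA m:M. {n. n < p \<and> \<not> int p dvd int n * (int n + t - int m)})"
    by (simp add: local_survivors_def card_image)
  also have "\<dots> = (\<Sum>m\<in>M. card ({..<p} - {0, r m}))"
    unfolding inner by (subst card_SigmaI) (auto simp: M_def)
  also have "\<dots> = (\<Sum>m\<in>M. p - 2 + (if m = nat (t mod int p) then 1 else 0))"
    by (intro sum.cong refl cinner) (auto simp: M_def)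
  also have "\<dots> = card M * (p - 2) + (if nat (t mod int p) \<in> M then 1 else 0)"
    by (subst sum.distrib) (simp add: M_def)
  also have "card M = p - 2"
  proof -
    have "card M = card {..<p} - card {0, p - 2}"
      unfolding M_def using p3 by (intro card_Diff_subset) auto
    then show ?thesis using p3 by simp
  qed
  finally show ?thesis by (auto simp: power2_eq_square)
qed

text \<open>
  The last inequality states that the sieve has dimension at least four at every odd prime:
  \<open>(p + 1) ^ 4 * ((p - 2)\<^sup>2 + 1) \<le> p ^ 6\<close> for \<open>p \<ge> 3\<close>.
\<close>

lemma local_survivors_bounds:
  assumes p: "prime p" "odd p"
  shows "1 \<le> local_survivors t p" "local_survivors t p < p\<^sup>2"
    "(1 + 1 / real p) ^ 4 * real (local_survivors t p) \<le> (real p)\<^sup>2"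
proof -
  have "p \<ge> 3" using prime_ge_2_nat[OF p(1)] p(2) by (cases "p = 2") auto
  then obtain k where k: "p = k + 3" by (metis add.commute le_Suc_ex)
  have ub: "local_survivors t p \<le> (k + 1)\<^sup>2 + 1" and lb: "1 \<le> local_survivors t p"
    using local_survivors_eq[OF p, of t] by (auto simp: k numeral_3_eq_3)
  show "1 \<le> local_survivors t p" by (rule lb)
  have "(k + 1)\<^sup>2 + 1 < p\<^sup>2" by (simp add: k power2_eq_square algebra_simps)
  then show "local_survivors t p < p\<^sup>2" using ub by linarith
  define x where "x = real p"
  have x: "x \<ge> 3" by (simp add: x_def k)
  have "5 * x ^ 4 - 15 * x\<^sup>2 - 16 * x - 5 \<ge> 0"
  proof -
    have "3 * x \<le> x\<^sup>2" using x mult_right_mono[of 3 x x] by (simp add: power2_eq_square)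
    moreover from this x have "x\<^sup>2 \<ge> 9" by linarith
    then have "9 * x\<^sup>2 \<le> x\<^sup>2 * x\<^sup>2" by (intro mult_right_mono) auto
    then have "9 * x\<^sup>2 \<le> x ^ 4" by (simp flip: power_add)
    ultimately show ?thesis using x by linarith
  qed
  moreover have "x ^ 6 - (x + 1) ^ 4 * ((x - 2)\<^sup>2 + 1) = 5 * x ^ 4 - 15 * x\<^sup>2 - 16 * x - 5"
    by algebra
  ultimately have "(x + 1) ^ 4 * ((x - 2)\<^sup>2 + 1) \<le> x ^ 6" by linarith
  moreover have "real (local_survivors t p) \<le> (x - 2)\<^sup>2 + 1"
  proof -
    have "real (local_survivors t p) \<le> real ((k + 1)\<^sup>2 + 1)" using ub by (simp only: of_nat_le_iff)
    then show ?thesis by (simp add: x_def k)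
  qed
  then have "(x + 1) ^ 4 * real (local_survivors t p) \<le> (x + 1) ^ 4 * ((x - 2)\<^sup>2 + 1)"
    by (intro mult_left_mono) auto
  ultimately have "(x + 1) ^ 4 * real (local_survivors t p) \<le> x\<^sup>2 * x ^ 4"
    by (simp flip: power_add)
  then have "(real p + 1) ^ 4 * real (local_survivors t p) \<le> (real p)\<^sup>2 * real p ^ 4"
    by (simp add: x_def)
  moreover have "1 + 1 / real p = (real p + 1) / real p" using k by (simp add: field_simps)
  ultimately show "(1 + 1 / real p) ^ 4 * real (local_survivors t p) \<le> (real p)\<^sup>2"
    using k by (simp add: power_divide pos_divide_le_eq)
qed

section \<open>Sieving four linear forms in two variables\<close>

definition sifted :: "nat \<Rightarrow> nat \<Rightarrow> int \<Rightarrow> (nat \<times> nat) set" where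
  "sifted N D t = {(n, m). n < N \<and> m < N \<and>
     (\<forall>p. prime p \<longrightarrow> odd p \<longrightarrow> p \<le> D \<longrightarrow> \<not> int p dvd twin_form t n m)}"

lemma finite_sifted: "finite (sifted N D t)"
  by (rule finite_subset[of _ "{..<N} \<times> {..<N}"]) (auto simp: sifted_def)

definition local_density :: "int \<Rightarrow> nat \<Rightarrow> real" where
  "local_density t p = 1 - real (local_survivors t p) / (real p)\<^sup>2"

lemma local_density_eq_sum:
  assumes "p > 0"
  shows "local_density t p = (\<Sum>n<p. \<Sum>m<p. of_bool (int p dvd twin_form t n m)) / (real p)\<^sup>2"
proof -
  define Q where "Q = {..<p} \<times> {..<p}"
  define V where "V = {(n, m). n < p \<and> m < p \<and> \<not> int p dvd twin_form t n m}"
  have V: "V \<subseteq> Q" "finite Q" "card Q = p\<^sup>2" by (auto simp: V_def Q_def power2_eq_square)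
  have "(\<Sum>n<p. \<Sum>m<p. of_bool (int p dvd twin_form t n m) :: real)
      = (\<Sum>(n, m)\<in>Q. of_bool (int p dvd twin_form t n m))"
    by (simp only: sum.cartesian_product Q_def)
  also have "\<dots> = (\<Sum>x\<in>Q. if x \<in> V then 0 else 1)"
    by (rule sum.cong) (auto simp: Q_def V_def)
  also have "\<dots> = real (card (Q - V))"
    using V by (simp add: sum.If_cases Diff_eq)
  also have "\<dots> = (real p)\<^sup>2 - real (local_survivors t p)"
    using V card_mono[OF V(2,1)] finite_subset[OF V(1,2)]
    by (simp add: card_Diff_subset of_nat_diff local_survivors_def flip: V_def)
  finally show ?thesis using assms by (simp add: local_density_def diff_divide_distrib)
qed

lemma local_density_bounds:
  assumes p: "prime p" "odd p"
  shows "0 < local_density t p" "local_density t p < 1"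
    "1 / (1 - local_density t p) \<le> (real p)\<^sup>2"
    "(1 + 1 / real p) ^ 4 - 1 \<le> local_density t p / (1 - local_density t p)"
proof -
  define s where "s = real (local_survivors t p)"
  define q where "q = (real p)\<^sup>2"
  have p0: "real p > 0" using p by (simp add: prime_gt_0_nat)
  have s: "1 \<le> s" "s < q" "(1 + 1 / real p) ^ 4 * s \<le> q"
    using local_survivors_bounds[OF p, of t] unfolding s_def q_def
    by (simp_all flip: of_nat_power)
  have g: "local_density t p = 1 - s / q" by (simp add: local_density_def s_def q_def)
  have q0: "q > 0" using s by linarith
  show "0 < local_density t p" "local_density t p < 1" using s q0 by (auto simp: g)
  have "1 / (1 - local_density t p) = q / s" by (simp add: g)
  also have "\<dots> \<le> q" using s q0 by (simp add: divide_le_eq)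
  finally show "1 / (1 - local_density t p) \<le> (real p)\<^sup>2" by (simp add: q_def)
  have "local_density t p / (1 - local_density t p) = q / s - 1"
    using s q0 by (simp add: g field_simps)
  moreover have "(1 + 1 / real p) ^ 4 \<le> q / s" using s by (simp add: le_divide_eq)
  ultimately show "(1 + 1 / real p) ^ 4 - 1 \<le> local_density t p / (1 - local_density t p)" by simp
qed

text \<open>
  The remainder estimate that the sieve needs: divisibility by all primes in \<open>S\<close> is periodic modulo
  \<open>\<Prod>S\<close> in both variables, and its density factors by the Chinese remainder theorem.
\<close>

lemma card_divisible_box:
  assumes S: "finite S" "\<And>p. p \<in> S \<Longrightarrow> prime p"
  shows "\<bar>real (card {(n, m). n < N \<and> m < N \<and> (\<forall>p\<in>S. int p dvd twin_form t n m)})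
      - (real N)\<^sup>2 * prod (local_density t) S\<bar> \<le> 2 * real N * real (\<Prod>S)"
proof -
  define f :: "nat \<Rightarrow> nat \<Rightarrow> nat \<Rightarrow> real" where "f p n m = of_bool (int p dvd twin_form t n m)" for p n m
  define F where "F n m = (\<Prod>p\<in>S. f p n m)" for n m
  have F: "F n m = of_bool (\<forall>p\<in>S. int p dvd twin_form t n m)" for n m
    using S(1) by (auto simp: F_def f_def prod_zero_iff)
  have per: "f p (n + p) m = f p n m" "f p n (m + p) = f p n m" for p n m
    by (simp_all add: f_def twin_form_periodic)
  have pos: "\<Prod>S > 0" using S by (intro prod_pos) (auto intro: prime_gt_0_nat)
  have "\<bar>(\<Sum>n<N. \<Sum>m<N. F n m) - (real N)\<^sup>2 * ((\<Sum>n<\<Prod>S. \<Sum>m<\<Prod>S. F n m) / (real (\<Prod>S))\<^sup>2)\<bar>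
      \<le> 2 * real N * real (\<Prod>S)"
  proof (rule sum_periodic_square[OF pos])
    show "F (n + \<Prod>S) m = F n m" for n m
      unfolding F_def using S per by (intro periodic_prod[of S "\<lambda>p n. f p n m"]) auto
    show "F n (m + \<Prod>S) = F n m" for n m
      unfolding F_def using S per by (intro periodic_prod[of S "\<lambda>p. f p n"]) auto
  qed (auto simp: F)
  moreover have "(\<Sum>n<\<Prod>S. \<Sum>m<\<Prod>S. F n m) / (real (\<Prod>S))\<^sup>2 = prod (local_density t) S"
  proof -
    have "(\<Sum>n<\<Prod>S. \<Sum>m<\<Prod>S. F n m) = (\<Prod>p\<in>S. \<Sum>n<p. \<Sum>m<p. f p n m)"
      unfolding F_def using S per by (intro sum_square_prod_periodic) auto
    then have "(\<Sum>n<\<Prod>S. \<Sum>m<\<Prod>S. F n m) / (real (\<Prod>S))\<^sup>2 = (\<Prod>p\<in>S. (\<Sum>n<p. \<Sum>m<p. f p n m) / (real p)\<^sup>2)"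
      by (simp add: prod_dividef prod_power_distrib)
    also have "\<dots> = prod (local_density t) S"
      by (rule prod.cong) (use S in \<open>auto simp: local_density_eq_sum f_def prime_gt_0_nat\<close>)
    finally show ?thesis .
  qed
  moreover have "(\<Sum>n<N. \<Sum>m<N. F n m)
      = real (card {(n, m). n < N \<and> m < N \<and> (\<forall>p\<in>S. int p dvd twin_form t n m)})"
  proof -
    have "(\<Sum>n<N. \<Sum>m<N. F n m) = (\<Sum>x\<in>{..<N} \<times> {..<N}. of_bool (\<forall>p\<in>S. int p dvd twin_form t (fst x) (snd x)))"
      by (simp only: F sum.cartesian_product case_prod_unfold)
    also have "\<dots> = real (card ({..<N} \<times> {..<N} \<inter> {x. \<forall>p\<in>S. int p dvd twin_form t (fst x) (snd x)}))"
      by (subst sum_of_bool_eq) auto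
    also have "{..<N} \<times> {..<N} \<inter> {x. \<forall>p\<in>S. int p dvd twin_form t (fst x) (snd x)}
        = {(n, m). n < N \<and> m < N \<and> (\<forall>p\<in>S. int p dvd twin_form t n m)}" by auto
    finally show ?thesis .
  qed
  ultimately show ?thesis by (simp only:)
qed

text \<open>
  Selberg's sieve of level \<open>y ^ 4\<close>: the denominator is at least the fourth power of a sum of reciprocals
  up to \<open>y\<close>. In the error term, \<open>2 N D\<^sup>2\<close> bounds each remainder, and \<open>D\<^sup>3\<close> bounds the sum of the
  absolute values of the weights, as \<open>1 / (1 - g p) \<le> p\<^sup>2\<close> for each prime; here \<open>D = y ^ 4\<close>.
\<close>

lemma card_sifted_le:
  assumes y: "y \<ge> 1"
  shows "real (card (sifted N (y ^ 4) t)) \<le> (4 ^ 4 * (real N)\<^sup>2) / ln (real y + 1) ^ 4 + 2 * real N * real y ^ 32"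
proof -
  define D where "D = y ^ 4"
  define \<D> where "\<D> = odd_prime_sets D"
  define B where "B = (\<lambda>(n, m). {p. int p dvd twin_form t n m})"
  have D: "D \<ge> 1" using y by (simp add: D_def)
  have mem: "p \<in> \<Union>\<D> \<longleftrightarrow> prime p \<and> odd p \<and> p \<le> D" for p
  proof
    assume "p \<in> \<Union>\<D>"
    then show "prime p \<and> odd p \<and> p \<le> D"
      using odd_prime_sets_subset_Pow[of D] by (auto simp: \<D>_def odd_prime_sets_def)
  next
    assume "prime p \<and> odd p \<and> p \<le> D"
    then have "{p} \<in> \<D>" by (simp add: \<D>_def odd_prime_sets_def)
    then show "p \<in> \<Union>\<D>" by blast
  qed
  have pr: "prime p" "odd p" if "p \<in> S" "S \<in> \<D>" for p S
    using that mem by blast+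
  have sieve: "real (card {a \<in> {..<N} \<times> {..<N}. B a \<inter> \<Union>\<D> = {}})
      \<le> (real N)\<^sup>2 / (\<Sum>S\<in>\<D>. \<Prod>p\<in>S. local_density t p / (1 - local_density t p))
        + 2 * real N * real (D * D) * (\<Sum>S\<in>\<D>. \<Prod>p\<in>S. 1 / (1 - local_density t p))\<^sup>2"
  proof (rule selberg_sieve)
    fix S T assume ST: "S \<in> \<D>" "T \<in> \<D>"
    then have Un: "S \<union> T \<in> odd_prime_sets (D * D)" by (simp add: \<D>_def odd_prime_sets_Un)
    have "{a \<in> {..<N} \<times> {..<N}. S \<union> T \<subseteq> B a}
        = {(n, m). n < N \<and> m < N \<and> (\<forall>p\<in>S \<union> T. int p dvd twin_form t n m)}"
      by (auto simp: B_def)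
    moreover have "\<bar>real (card {(n, m). n < N \<and> m < N \<and> (\<forall>p\<in>S \<union> T. int p dvd twin_form t n m)})
      - (real N)\<^sup>2 * prod (local_density t) (S \<union> T)\<bar> \<le> 2 * real N * real (\<Prod>(S \<union> T))"
      using Un by (intro card_divisible_box) (auto simp: odd_prime_sets_def)
    moreover have "2 * real N * real (\<Prod>(S \<union> T)) \<le> 2 * real N * real (D * D)"
      using Un unfolding odd_prime_sets_def by (intro mult_left_mono) (simp_all del: of_nat_mult of_nat_prod)
    ultimately show "\<bar>real (card {a \<in> {..<N} \<times> {..<N}. S \<union> T \<subseteq> B a})
        - (real N)\<^sup>2 * prod (local_density t) (S \<union> T)\<bar> \<le> 2 * real N * real (D * D)"
      by simp
  next
    show "0 < local_density t p \<and> local_density t p < 1" if "p \<in> \<Union>\<D>" for p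
      using that mem[of p] local_density_bounds by blast
  qed (use D in \<open>auto simp: \<D>_def finite_odd_prime_sets intro: odd_prime_sets_down,
        auto simp: odd_prime_sets_def\<close>)
  have main: "(ln (real y + 1) / 4) ^ 4 \<le> (\<Sum>S\<in>\<D>. \<Prod>p\<in>S. local_density t p / (1 - local_density t p))"
  proof -
    have "(ln (real y + 1) / 4) ^ 4 \<le> (\<Sum>S\<in>odd_prime_sets y. \<Prod>p\<in>S. 1 / real p) ^ 4"
      by (intro power_mono sum_odd_prime_sets_inverse_ge) auto
    also have "\<dots> \<le> (\<Sum>S\<in>\<D>. \<Prod>p\<in>S. (1 + 1 / real p) ^ 4 - 1)"
      unfolding \<D>_def D_def by (rule sum_odd_prime_sets_inverse_power4)
    also have "\<dots> \<le> (\<Sum>S\<in>\<D>. \<Prod>p\<in>S. local_density t p / (1 - local_density t p))"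
    proof (intro sum_mono prod_mono conjI)
      fix S p assume "S \<in> \<D>" "p \<in> S"
      then show "(1 + 1 / real p) ^ 4 - 1 \<le> local_density t p / (1 - local_density t p)"
        using pr by (intro local_density_bounds) blast+
      show "0 \<le> (1 + 1 / real p) ^ 4 - 1" by (simp add: one_le_power)
    qed
    finally show ?thesis .
  qed
  have weights: "(\<Sum>S\<in>\<D>. \<Prod>p\<in>S. 1 / (1 - local_density t p)) \<le> real D * (real D)\<^sup>2"
  proof -
    have "(\<Prod>p\<in>S. 1 / (1 - local_density t p)) \<le> (real D)\<^sup>2" if S: "S \<in> \<D>" for S
    proof -
      have "(\<Prod>p\<in>S. 1 / (1 - local_density t p)) \<le> (\<Prod>p\<in>S. (real p)\<^sup>2)"
        using pr[OF _ S] local_density_bounds(2,3)[of _ t] by (intro prod_mono) (auto simp: less_imp_le)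
      also have "\<dots> = (real (\<Prod>S))\<^sup>2" by (simp add: prod_power_distrib)
      also have "\<dots> \<le> (real D)\<^sup>2"
        using S by (intro power_mono) (simp_all add: \<D>_def odd_prime_sets_def del: of_nat_prod)
      finally show ?thesis .
    qed
    then have "(\<Sum>S\<in>\<D>. \<Prod>p\<in>S. 1 / (1 - local_density t p)) \<le> real (card \<D>) * (real D)\<^sup>2"
      by (rule sum_bounded_above)
    also have "\<dots> \<le> real D * (real D)\<^sup>2"
      unfolding \<D>_def by (intro mult_right_mono) (auto intro: card_odd_prime_sets)
    finally show ?thesis .
  qed
  have w0: "0 \<le> (\<Sum>S\<in>\<D>. \<Prod>p\<in>S. 1 / (1 - local_density t p))"
    using pr local_density_bounds(2)[of _ t] by (intro sum_nonneg prod_nonneg) (auto simp: less_imp_le)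
  have "sifted N (y ^ 4) t = {a \<in> {..<N} \<times> {..<N}. B a \<inter> \<Union>\<D> = {}}"
  proof -
    have "B (n, m) \<inter> \<Union>\<D> = {} \<longleftrightarrow> (\<forall>p. prime p \<longrightarrow> odd p \<longrightarrow> p \<le> D \<longrightarrow> \<not> int p dvd twin_form t n m)" for n m
      unfolding disjoint_iff by (simp add: mem B_def del: Union_iff) blast
    then show ?thesis by (auto simp: sifted_def simp flip: D_def)
  qed
  then have "real (card (sifted N (y ^ 4) t))
      \<le> (real N)\<^sup>2 / (\<Sum>S\<in>\<D>. \<Prod>p\<in>S. local_density t p / (1 - local_density t p))
        + 2 * real N * real (D * D) * (\<Sum>S\<in>\<D>. \<Prod>p\<in>S. 1 / (1 - local_density t p))\<^sup>2"
    using sieve by simp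
  also have "\<dots> \<le> (real N)\<^sup>2 / (ln (real y + 1) / 4) ^ 4 + 2 * real N * real (D * D) * (real D * (real D)\<^sup>2)\<^sup>2"
  proof (intro add_mono divide_left_mono mult_left_mono power_mono main weights w0)
    have "0 < (ln (real y + 1) / 4) ^ 4" using y by simp
    then show "0 < (\<Sum>S\<in>\<D>. \<Prod>p\<in>S. local_density t p / (1 - local_density t p)) * (ln (real y + 1) / 4) ^ 4"
      using main by (intro mult_pos_pos) linarith+
  qed auto
  also have "\<dots> = (4 ^ 4 * (real N)\<^sup>2) / ln (real y + 1) ^ 4 + 2 * real N * real y ^ 32"
  proof -
    have "x * x * (x * x\<^sup>2)\<^sup>2 = x ^ 8" for x :: real by algebra
    from this[of "real D"] have "real (D * D) * (real D * (real D)\<^sup>2)\<^sup>2 = real D ^ 8" by simp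
    also have "\<dots> = real y ^ 32" by (simp add: D_def flip: power_mult)
    finally have "2 * real N * real (D * D) * (real D * (real D)\<^sup>2)\<^sup>2 = 2 * real N * real y ^ 32"
      by (simp only: mult.assoc)
    moreover have "(real N)\<^sup>2 / (ln (real y + 1) / 4) ^ 4 = (4 ^ 4 * (real N)\<^sup>2) / ln (real y + 1) ^ 4"
      by (simp add: power_divide)
    ultimately show ?thesis by (simp only:)
  qed
  finally show ?thesis .
qed

text \<open>
  The exponent \<open>64\<close> is chosen so that the error term \<open>2 N y ^ 32\<close> of the sieve with \<open>y ^ 64 \<le> N\<close> is
  at most \<open>2 N * sqrt N\<close>.
\<close>

definition sieve_level :: "nat \<Rightarrow> nat" where
  "sieve_level N = nth_root_nat 64 N ^ 4"

lemma ln_power4_le_sqrt: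
  assumes "x \<ge> 1"
  shows "ln x ^ 4 \<le> 8 ^ 4 * sqrt x"
proof -
  \<comment> \<open>\<open>ln x = 8 * ln u\<close> and \<open>ln u \<le> u\<close>, where \<open>u ^ 4 = sqrt x\<close>\<close>
  define u where "u = x powr (1 / 8)"
  have u: "u > 0" "u ^ 8 = x" "u ^ 4 = sqrt x"
    using assms by (simp_all add: u_def powr_power powr_half_sqrt)
  have "ln x = 8 * ln u" using u by (simp add: ln_realpow flip: u(2))
  also have "\<dots> \<le> 8 * u" using ln_bound[of u] u by simp
  finally have "ln x ^ 4 \<le> (8 * u) ^ 4" using assms by (intro power_mono) auto
  then show ?thesis by (simp add: power_mult_distrib u)
qed

lemma mult_sqrt_le:
  assumes "N \<ge> 2"
  shows "real N * sqrt (real N) \<le> 8 ^ 4 * ((real N)\<^sup>2 / ln (real N) ^ 4)"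
proof -
  have "ln (real N) > 0" using assms by simp
  moreover have "real N * sqrt (real N) * ln (real N) ^ 4 \<le> real N * sqrt (real N) * (8 ^ 4 * sqrt (real N))"
    using ln_power4_le_sqrt[of "real N"] assms by (intro mult_left_mono) auto
  moreover have "real N * sqrt (real N) * (8 ^ 4 * sqrt (real N)) = 8 ^ 4 * (real N)\<^sup>2"
  proof -
    have "real N * sqrt (real N) * (8 ^ 4 * sqrt (real N)) = 8 ^ 4 * real N * (sqrt (real N) * sqrt (real N))"
      by (simp only: mult_ac)
    then show ?thesis by (simp add: power2_eq_square)
  qed
  ultimately have "real N * sqrt (real N) * ln (real N) ^ 4 \<le> 8 ^ 4 * (real N)\<^sup>2" by linarith
  then show ?thesis using \<open>ln (real N) > 0\<close> by (simp add: pos_le_divide_eq)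
qed

lemma sieve_level_le_sqrt:
  assumes "N \<ge> 1"
  shows "real (sieve_level N) \<le> sqrt (real N)"
proof -
  define y where "y = nth_root_nat 64 N"
  have y: "y ^ 64 \<le> N" by (simp add: y_def nth_root_nat_power_le)
  have "(real (sieve_level N))\<^sup>2 = real (y ^ 8)"
    by (simp add: sieve_level_def y_def flip: power_mult)
  also have "y ^ 8 \<le> y ^ 64"
    by (cases "y = 0") (auto intro: power_increasing)
  finally have "(real (sieve_level N))\<^sup>2 \<le> real N" using y by linarith
  then show ?thesis by (simp add: real_le_rsqrt)
qed

text \<open>
  Here \<open>256 = 4 * 64\<close> combines the factor \<open>4\<close> in the main term of the sieve bound with \<open>ln N \<le> 64 * ln (y + 1)\<close>, and
  \<open>8 ^ 4\<close> comes from \<open>ln x \<le> 8 * x powr (1 / 8)\<close>, which absorbs the error term.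
\<close>

lemma card_sifted_sieve_level_le:
  assumes N: "N \<ge> 2"
  shows "real (card (sifted N (sieve_level N) t)) \<le> (256 ^ 4 + 2 * 8 ^ 4) * ((real N)\<^sup>2 / ln (real N) ^ 4)"
proof -
  define y where "y = nth_root_nat 64 N"
  have y: "y ^ 64 \<le> N" "N < Suc y ^ 64"
    using nth_root_nat_ge[of 64 "Suc y" N] by (force simp: y_def nth_root_nat_power_le)+
  have y1: "y \<ge> 1" using y(2) N by (cases y) auto
  have ln: "0 < ln (real N)" using N by simp
  have "real N \<le> real (Suc y ^ 64)" using y(2) by linarith
  then have "ln (real N) \<le> ln ((real y + 1) ^ 64)" using N by (intro ln_mono) (auto simp: add.commute)
  then have "ln (real N) / 64 \<le> ln (real y + 1)" by (simp add: ln_realpow)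
  then have "(ln (real N) / 64) ^ 4 \<le> ln (real y + 1) ^ 4" using ln by (intro power_mono) auto
  then have "4 ^ 4 * (real N)\<^sup>2 / ln (real y + 1) ^ 4 \<le> 4 ^ 4 * (real N)\<^sup>2 / (ln (real N) / 64) ^ 4"
    using ln y1 by (intro divide_left_mono mult_pos_pos) auto
  also have "\<dots> = 256 ^ 4 * ((real N)\<^sup>2 / ln (real N) ^ 4)" by (simp add: power_divide)
  finally have 1: "4 ^ 4 * (real N)\<^sup>2 / ln (real y + 1) ^ 4 \<le> 256 ^ 4 * ((real N)\<^sup>2 / ln (real N) ^ 4)" .
  have "(real y ^ 32)\<^sup>2 = real (y ^ 64)" by (simp flip: power_mult)
  also have "\<dots> \<le> real N" using y(1) by linarith
  finally have "real y ^ 32 \<le> sqrt (real N)" by (rule real_le_rsqrt)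
  then have "2 * real N * real y ^ 32 \<le> 2 * (real N * sqrt (real N))"
    by (simp add: mult_left_mono)
  also have "\<dots> \<le> 2 * 8 ^ 4 * ((real N)\<^sup>2 / ln (real N) ^ 4)" using mult_sqrt_le[OF N] by simp
  finally have 2: "2 * real N * real y ^ 32 \<le> 2 * 8 ^ 4 * ((real N)\<^sup>2 / ln (real N) ^ 4)" .
  show ?thesis
    using card_sifted_le[OF y1, of N t] 1 2 unfolding sieve_level_def y_def[symmetric] distrib_right
    by linarith
qed

section \<open>Chebyshev's lower bound for the number of primes\<close>

text \<open>
  The numbers \<open>1 / ((n + 1) * (n choose k))\<close> form Leibniz's harmonic triangle: each is the difference of its
  upper and its left neighbour, and its left border is \<open>1 / (n + 1)\<close>. Hence a common multiple of
  \<open>1, \<dots>, n + 1\<close> clears all denominators up to row \<open>n\<close>.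
\<close>

lemma Leibniz_triangle_integral:
  assumes "\<And>j. 1 \<le> j \<Longrightarrow> j \<le> Suc n \<Longrightarrow> j dvd D" "k \<le> n"
  shows "real D / (real (Suc n) * real (n choose k)) \<in> \<int>"
  using assms
proof (induction n arbitrary: k)
  case (Suc m)
  note outer = Suc
  show ?case using outer(3)
  proof (induction k)
    case 0
    have "Suc (Suc m) dvd D" using outer(2) by simp
    then obtain q where "D = Suc (Suc m) * q" by (rule dvdE)
    then have "real D / real (Suc (Suc m)) = real q" by (simp add: field_simps)
    then have "real D / (real (Suc (Suc m)) * real (Suc m choose 0)) = real q"
      unfolding binomial_n_0 by simp
    then show ?case by simp
  next
    case (Suc k)
    define C where "C = real (m choose k)"
    have C: "C > 0" using Suc.prems by (simp add: C_def)
    have e1: "real (Suc m choose k) = (real m + 1) * C / (real m + 1 - real k)"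
    proof -
      have "(Suc m - k) * (Suc m choose k) = Suc m * (m choose k)"
        using binomial_absorb_comp[of "Suc m" k] by simp
      then have "real ((Suc m - k) * (Suc m choose k)) = real (Suc m * (m choose k))" by (simp only:)
      then show ?thesis using Suc.prems by (simp add: C_def of_nat_diff field_simps)
    qed
    have e2: "real (Suc m choose Suc k) = (real m + 1) * C / (real k + 1)"
    proof -
      have "real (Suc k * (Suc m choose Suc k)) = real (Suc m * (m choose k))"
        by (simp only: Suc_times_binomial)
      then show ?thesis unfolding of_nat_mult by (simp add: C_def field_simps del: binomial_Suc_Suc)
    qed
    have "real m + 1 - real k > 0" using Suc.prems by simp
    then have "real D / (real (Suc (Suc m)) * real (Suc m choose Suc k))
        = real D / (real (Suc m) * real (m choose k)) - real D / (real (Suc (Suc m)) * real (Suc m choose k))"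
      unfolding e1 e2 C_def[symmetric] using C by (simp add: divide_simps) (simp add: algebra_simps)
    \<comment> \<open>the upper neighbour comes from the previous row, the left neighbour from the same row\<close>
    moreover have "real D / (real (Suc m) * real (m choose k)) \<in> \<int>"
      using outer(1)[of k] outer(2) Suc.prems by simp
    moreover have "real D / (real (Suc (Suc m)) * real (Suc m choose k)) \<in> \<int>"
      using Suc by simp
    ultimately show ?case using Ints_diff by metis
  qed
qed simp

lemma Suc_times_binomial_dvd:
  assumes "\<And>j. 1 \<le> j \<Longrightarrow> j \<le> Suc n \<Longrightarrow> j dvd D" "k \<le> n"
  shows "Suc n * (n choose k) dvd D"
proof -
  obtain z where z: "real D / (real (Suc n) * real (n choose k)) = of_int z"
    using Leibniz_triangle_integral[OF assms] by (auto elim: Ints_cases)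
  have "Suc n * (n choose k) \<noteq> 0" using assms(2) by simp
  then have "real (Suc n * (n choose k)) \<noteq> 0" unfolding of_nat_eq_0_iff .
  then have "real D = real (Suc n * (n choose k)) * of_int z"
    using z by (simp add: field_simps)
  then have "int D = int (Suc n * (n choose k)) * z"
    by (metis of_int_eq_iff of_int_mult of_int_of_nat_eq)
  then have "int (Suc n * (n choose k)) dvd int D" by simp
  then show ?thesis by (simp only: int_dvd_int_iff)
qed

lemma prime_power_multiplicity_Lcm_le:
  assumes "prime p" "m \<ge> 1"
  shows "p ^ multiplicity p (Lcm {1..m}) \<le> (m::nat)"
  using assms(2)
proof (induction m rule: nat_induct_at_least)
  case (Suc m)
  have nz: "Lcm {1..m} \<noteq> (0::nat)" by (simp add: Lcm_0_iff)
  have "Lcm {1..Suc m} = lcm (Suc m) (Lcm {1..m})"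
    by (simp add: atLeastAtMostSuc_conv)
  then have "multiplicity p (Lcm {1..Suc m}) = max (multiplicity p (Suc m)) (multiplicity p (Lcm {1..m}))"
    using nz assms(1) prime_factorization_lcm[of "Suc m" "Lcm {1..m}"]
    by (simp flip: count_prime_factorization_prime)
  moreover have "p ^ multiplicity p (Suc m) \<le> Suc m"
    by (rule dvd_imp_le) (auto simp: multiplicity_dvd)
  ultimately show ?case using Suc.IH by (simp add: max_def)
qed simp

text \<open>
  Each prime contributes to the least common multiple a power that is at most \<open>m\<close>.
\<close>

lemma Lcm_upto_le_power_card_primes:
  assumes "m \<ge> 1"
  shows "Lcm {1..m} \<le> m ^ card {p. prime p \<and> p \<le> (m::nat)}"
proof -
  define L where "L = Lcm {1..m}"
  have L: "L > 0" by (simp add: L_def zero_less_iff_neq_zero Lcm_0_iff)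
  have le: "p ^ multiplicity p L \<le> m" if "p \<in> prime_factors L" for p
    unfolding L_def using that assms by (intro prime_power_multiplicity_Lcm_le) auto
  have "L = (\<Prod>p\<in>prime_factors L. p ^ multiplicity p L)"
    by (rule prime_factorization_nat[OF L])
  also have "\<dots> \<le> (\<Prod>p\<in>prime_factors L. m)"
    by (intro prod_mono conjI le) auto
  also have "\<dots> = m ^ card (prime_factors L)" by simp
  also have "\<dots> \<le> m ^ card {p. prime p \<and> p \<le> m}"
  proof (rule power_increasing[OF card_mono])
    show "prime_factors L \<subseteq> {p. prime p \<and> p \<le> m}"
    proof
      fix p assume p: "p \<in> prime_factors L"
      then have "multiplicity p L \<ge> 1" by (simp add: prime_factors_multiplicity Suc_le_eq)
      then have "p ^ 1 \<le> p ^ multiplicity p L"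
        using p by (intro power_increasing) (auto dest!: in_prime_factors_imp_prime prime_ge_1_nat)
      with le[OF p] p show "p \<in> {p. prime p \<and> p \<le> m}" by auto
    qed
  qed (use assms in auto)
  finally show ?thesis by (simp add: L_def)
qed

text \<open>
  The number \<open>(2 n + 1) * ((2 n) choose n)\<close> is at least \<open>4 ^ n\<close> and divides the least common
  multiple of \<open>1, \<dots>, 2 n + 1\<close>, which is at most \<open>(2 n + 1) ^ k\<close> if there are \<open>k\<close> primes up to
  \<open>2 n + 1\<close>.
\<close>

lemma Chebyshev_lower_bound:
  assumes "N \<ge> 6"
  shows "real N / (4 * ln (real N)) \<le> real (card {p. prime p \<and> p < N})"
proof -
  define n where "n = (N - 2) div 2"
  define P where "P = card {p. prime p \<and> p \<le> 2 * n + 1}"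
  have n: "n \<ge> 1" "2 * n + 1 < N" "real N / 4 \<le> real n"
  proof -
    have "N \<le> 4 * n" "2 * n + 1 < N" "n \<ge> 1" using assms unfolding n_def by linarith+
    then show "n \<ge> 1" "2 * n + 1 < N" "real N / 4 \<le> real n" by simp_all
  qed
  have "4 ^ n \<le> 2 * real n * real ((2 * n) choose n)"
    using central_binomial_lower_bound[of n] n by (simp add: field_simps)
  also have "\<dots> \<le> real (Suc (2 * n) * ((2 * n) choose n))"
    by (simp add: algebra_simps)
  also have "Suc (2 * n) * ((2 * n) choose n) \<le> Lcm {1..Suc (2 * n)}"
  proof (rule dvd_imp_le)
    show "Suc (2 * n) * ((2 * n) choose n) dvd Lcm {1..Suc (2 * n)}"
      by (rule Suc_times_binomial_dvd) (simp_all add: dvd_Lcm)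
    show "0 < Lcm {1..Suc (2 * n)}"
      unfolding zero_less_iff_neq_zero by (subst Lcm_0_iff) (simp_all del: Lcm_0_iff)
  qed
  also have "\<dots> \<le> (2 * n + 1) ^ P"
    using Lcm_upto_le_power_card_primes[of "2 * n + 1"] by (simp add: P_def)
  also have "\<dots> \<le> N ^ P" using n by (intro power_mono) auto
  finally have "4 ^ n \<le> real N ^ P" by simp
  then have "ln (4 ^ n) \<le> ln (real N ^ P)" by (intro ln_mono) auto
  then have 1: "real n * ln 4 \<le> real P * ln (real N)"
    using assms by (simp add: ln_realpow)
  have "1 \<le> ln (4::real)"
    using exp_le by (simp add: ln_ge_iff)
  then have "real n * 1 \<le> real n * ln 4" by (intro mult_left_mono) auto
  with 1 n(3) have "real N / 4 \<le> real P * ln (real N)" by linarith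
  moreover have "P \<le> card {p. prime p \<and> p < N}"
    unfolding P_def using n by (intro card_mono) auto
  moreover have ln: "ln (real N) > 0" using assms by simp
  ultimately have "real N / 4 \<le> real (card {p. prime p \<and> p < N}) * ln (real N)"
    by (meson mult_right_mono less_imp_le of_nat_le_iff order_trans)
  then show ?thesis using ln by (simp add: field_simps)
qed

section \<open>Additive energy of primes and twin members\<close>

text \<open>
  Primes above the sieving level, so that no prime used for sieving divides them.
\<close>

definition large_primes :: "nat \<Rightarrow> nat set" where
  "large_primes N = {p. prime p \<and> odd p \<and> sieve_level N < p \<and> p < N}"

definition twins_below :: "nat \<Rightarrow> nat set" where
  "twins_below N = {t \<in> twin_members. t < N}"

lemma finite_large_primes: "finite (large_primes N)"
  by (rule finite_subset[of _ "{..<N}"]) (auto simp: large_primes_def)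

lemma finite_twins_below: "finite (twins_below N)"
  by (rule finite_subset[of _ "{..<N}"]) (auto simp: twins_below_def)

lemma odd_twin_member:
  assumes "t \<in> twin_members"
  shows "odd t"
proof (rule ccontr)
  assume "\<not> odd t"
  moreover have "prime t" using assms by (simp add: twin_members_def)
  ultimately have "t = 2" using prime_odd_nat[of t] prime_ge_2_nat[of t] by fastforce
  moreover have "\<not> prime (4::nat)"
    using prime_product[of 2 2] by auto
  ultimately show False using assms by (auto simp: twin_members_def)
qed

lemma in_siftedI:
  assumes "n < N" "m < N" and t: "int n + t - int m = int k"
    and "prime n" "D < n" "prime k" "D < k" "prime m" "D < m" "prime (m + 2)"
  shows "(n, m) \<in> sifted N D t"
proof -
  have not_dvd: "\<not> q dvd r" if "prime q" "q \<le> D" "prime r" "D < r" for q r :: nat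
    using that primes_dvd_imp_eq[of q r] by auto
  have form: "twin_form t n m = int (n * k * m * (m + 2))"
    unfolding twin_form_def t by (simp add: algebra_simps)
  have "\<not> int q dvd twin_form t n m" if q: "prime q" "q \<le> D" for q
  proof -
    have "\<not> q dvd n * k * m * (m + 2)"
      using not_dvd[OF q, of n] not_dvd[OF q, of k] not_dvd[OF q, of m] not_dvd[OF q, of "m + 2"] assms q(1)
      by (simp add: prime_dvd_mult_iff del: add_2_eq_Suc')
    then show ?thesis unfolding form int_dvd_int_iff .
  qed
  then show ?thesis using assms by (auto simp: sifted_def)
qed

text \<open>
  Twice the constant of the sieve bound, once for each position of \<open>s\<close> in its twin pair, plus the
  cost of the small \<open>s\<close>.
\<close>

definition energy_const :: real where
  "energy_const = 2 * (256 ^ 4 + 2 * 8 ^ 4) + 4 * 8 ^ 4"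

text \<open>
  A solution of \<open>p' + s = p + t\<close> with \<open>s\<close> above the sieving level by more than \<open>2\<close> gives the sifted
  pair \<open>(p, s)\<close> for \<open>t\<close> if \<open>s + 2\<close> is prime, and the sifted pair \<open>(p, s - 2)\<close> for \<open>t - 2\<close> if \<open>s - 2\<close> is
  prime. The remaining small \<open>s\<close> are so few that the trivial bound suffices.
  The diagonal \<open>s = t\<close> is covered as well.
\<close>

lemma card_equal_sums_le:
  assumes N: "N \<ge> 2"
  shows "real (card {(p, s). p \<in> large_primes N \<and> s \<in> twins_below N \<and> (\<exists>p'\<in>large_primes N. p' + s = p + t)})
    \<le> energy_const * ((real N)\<^sup>2 / ln (real N) ^ 4)"
proof -
  have energy: "energy_const * X = (256 ^ 4 + 2 * 8 ^ 4) * X + (256 ^ 4 + 2 * 8 ^ 4) * X + 4 * 8 ^ 4 * X" for X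
    by (simp add: energy_const_def)
  define D where "D = sieve_level N"
  define A where "A = {(p, s). p \<in> large_primes N \<and> s \<in> twins_below N \<and> (\<exists>p'\<in>large_primes N. p' + s = p + t)}"
  define S1 where "S1 = {..<N} \<times> {..D + 2}"
  define S2 where "S2 = sifted N D (int t)"
  define S3 where "S3 = (\<lambda>(n, m). (n, m + 2)) ` sifted N D (int t - 2)"
  have "A \<subseteq> S1 \<union> (S2 \<union> S3)"
  proof (rule subsetI)
    fix x assume "x \<in> A"
    then obtain p s q where x: "x = (p, s)" and p: "prime p" "D < p" "p < N"
      and s: "s \<in> twin_members" "s < N" and q: "prime q" "D < q" "q + s = p + t"
      by (auto simp: A_def large_primes_def twins_below_def D_def)
    have ps: "prime s" using s by (simp add: twin_members_def)
    show "x \<in> S1 \<union> (S2 \<union> S3)"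
    proof (cases "s \<le> D + 2")
      case True
      then show ?thesis using x p by (auto simp: S1_def)
    next
      case large: False
      show ?thesis
      proof (cases "prime (s + 2)")
        case True
        have "(p, s) \<in> sifted N D (int t)"
          using p s q ps large True by (intro in_siftedI[where k = q]) auto
        then show ?thesis by (simp add: x S2_def)
      next
        case False
        then have pr: "prime (s - 2)" using s(1) by (simp add: twin_members_def)
        have "(p, s - 2) \<in> sifted N D (int t - 2)"
        proof (rule in_siftedI[where k = q])
          show "prime (s - 2 + 2)" using ps large le_add_diff_inverse2[of 2 s] by simp
        qed (use p s q large pr in auto)
        moreover have "(p, s) = (\<lambda>(n, m). (n, m + 2)) (p, s - 2)" using large by simp
        ultimately show ?thesis unfolding x S3_def by blast
      qed
    qed
  qed
  then have "card A \<le> card (S1 \<union> (S2 \<union> S3))"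
    by (intro card_mono) (auto simp: S1_def S2_def S3_def finite_sifted)
  also have "\<dots> \<le> card S1 + (card S2 + card S3)"
    using card_Un_le[of S1 "S2 \<union> S3"] card_Un_le[of S2 S3] by linarith
  finally have "real (card A) \<le> real (card S1) + (real (card S2) + real (card S3))" by linarith
  moreover have "real (card S2) \<le> (256 ^ 4 + 2 * 8 ^ 4) * ((real N)\<^sup>2 / ln (real N) ^ 4)"
    unfolding S2_def D_def by (rule card_sifted_sieve_level_le[OF N])
  moreover have "real (card S3) \<le> (256 ^ 4 + 2 * 8 ^ 4) * ((real N)\<^sup>2 / ln (real N) ^ 4)"
  proof -
    have "card S3 \<le> card (sifted N D (int t - 2))"
      unfolding S3_def by (rule card_image_le[OF finite_sifted])
    moreover have "real (card (sifted N D (int t - 2))) \<le> (256 ^ 4 + 2 * 8 ^ 4) * ((real N)\<^sup>2 / ln (real N) ^ 4)"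
      unfolding D_def by (rule card_sifted_sieve_level_le[OF N])
    ultimately show ?thesis by linarith
  qed
  moreover have "real (card S1) \<le> 4 * 8 ^ 4 * ((real N)\<^sup>2 / ln (real N) ^ 4)"
  proof -
    have "1 \<le> sqrt (real N)" using N by simp
    then have "real D + 3 \<le> 4 * sqrt (real N)" using sieve_level_le_sqrt[of N] N unfolding D_def by linarith
    then have "real N * (real D + 3) \<le> real N * (4 * sqrt (real N))" by (intro mult_left_mono) auto
    moreover have "real (card S1) = real N * (real D + 3)" by (simp add: S1_def algebra_simps)
    ultimately show ?thesis using mult_sqrt_le[OF N] by simp
  qed
  ultimately show ?thesis unfolding A_def[symmetric] energy by linarith
qed

lemma card_squared_le_card_image_mult_energy:
  fixes f :: "'a \<Rightarrow> 'b"
  assumes fin: "finite Q"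
  shows "(real (card Q))\<^sup>2 \<le> real (card (f ` Q)) * (\<Sum>x\<in>Q. real (card {y \<in> Q. f y = f x}))"
proof -
  define r where "r v = real (card {y \<in> Q. f y = v})" for v
  have group: "(\<Sum>v\<in>f ` Q. \<Sum>x | x \<in> Q \<and> f x = v. h x) = sum h Q" for h :: "'a \<Rightarrow> real"
    by (rule sum.group) (use fin in auto)
  have "(real (card Q))\<^sup>2 = (\<Sum>v\<in>f ` Q. r v * 1)\<^sup>2"
    using group[of "\<lambda>_. 1"] by (simp add: r_def)
  also have "\<dots> \<le> (\<Sum>v\<in>f ` Q. (r v)\<^sup>2) * (\<Sum>v\<in>f ` Q. 1\<^sup>2)"
    by (rule Cauchy_Schwarz_ineq_sum)
  also have "(\<Sum>v\<in>f ` Q. (r v)\<^sup>2) = (\<Sum>v\<in>f ` Q. \<Sum>x | x \<in> Q \<and> f x = v. r (f x))"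
    by (intro sum.cong refl) (simp add: r_def power2_eq_square)
  also have "\<dots> = (\<Sum>x\<in>Q. r (f x))" by (rule group)
  finally show ?thesis by (simp add: r_def mult.commute)
qed

text \<open>
  For fixed \<open>t\<close> the prime \<open>p'\<close> is determined by \<open>p\<close> and \<open>s\<close>. Only one of the two twin members is
  sieved, so the bound keeps the exact number of twin members as a factor.
\<close>

lemma energy_le:
  assumes N: "N \<ge> 2"
  shows "(\<Sum>(p, t)\<in>large_primes N \<times> twins_below N.
      real (card {(p', s) \<in> large_primes N \<times> twins_below N. p' + s = p + t}))
    \<le> real (card (twins_below N)) * (energy_const * ((real N)\<^sup>2 / ln (real N) ^ 4))"
proof -
  define P T where "P = large_primes N" and "T = twins_below N"
  have fin: "finite P" "finite T" by (auto simp: P_def T_def finite_large_primes finite_twins_below)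
  have "(\<Sum>(p, t)\<in>P \<times> T. real (card {(p', s) \<in> P \<times> T. p' + s = p + t}))
      = (\<Sum>t\<in>T. \<Sum>p\<in>P. real (card {(p', s) \<in> P \<times> T. p' + s = p + t}))"
    by (simp add: sum.cartesian_product[symmetric]) (rule sum.swap)
  also have "\<dots> \<le> (\<Sum>t\<in>T. energy_const * ((real N)\<^sup>2 / ln (real N) ^ 4))"
  proof (rule sum_mono)
    fix t
    have "card {(p', s) \<in> P \<times> T. p' + s = p + t} = card {s \<in> T. \<exists>p'\<in>P. p' + s = p + t}" for p
    proof (rule bij_betw_same_card)
      show "bij_betw snd {(p', s) \<in> P \<times> T. p' + s = p + t} {s \<in> T. \<exists>p'\<in>P. p' + s = p + t}"
        by (rule bij_betwI[where g = "\<lambda>s. (p + t - s, s)"]) (auto, metis add_diff_cancel_right')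
    qed
    then have "(\<Sum>p\<in>P. real (card {(p', s) \<in> P \<times> T. p' + s = p + t}))
        = real (card (SIGMA p:P. {s \<in> T. \<exists>p'\<in>P. p' + s = p + t}))"
      using fin by (simp add: card_SigmaI)
    also have "(SIGMA p:P. {s \<in> T. \<exists>p'\<in>P. p' + s = p + t})
        = {(p, s). p \<in> P \<and> s \<in> T \<and> (\<exists>p'\<in>P. p' + s = p + t)}" by auto
    also have "real (card \<dots>) \<le> energy_const * ((real N)\<^sup>2 / ln (real N) ^ 4)"
      unfolding P_def T_def by (rule card_equal_sums_le[OF N])
    finally show "(\<Sum>p\<in>P. real (card {(p', s) \<in> P \<times> T. p' + s = p + t}))
        \<le> energy_const * ((real N)\<^sup>2 / ln (real N) ^ 4)" .
  qed
  finally show ?thesis unfolding P_def T_def by simp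
qed

text \<open>
  Chebyshev's bound; the primes up to the sieving level are at most \<open>sqrt N\<close> in number.
\<close>

lemma card_large_primes_ge:
  "\<forall>\<^sub>F N in at_top. real N / (8 * ln (real N)) \<le> real (card (large_primes N))"
proof -
  have "\<forall>\<^sub>F N in at_top. real N / (8 * ln (real N)) \<le> real N / (4 * ln (real N)) - sqrt (real N) - 2"
    by real_asymp
  then show ?thesis using eventually_ge_at_top[of 6]
  proof eventually_elim
    case (elim N)
    have "{p. prime p \<and> p < N} \<subseteq> large_primes N \<union> ({..sieve_level N} \<union> {2})"
      by (auto simp: large_primes_def not_less) (metis prime_odd_nat le_less_linear le_antisym prime_ge_2_nat)
    then have "card {p. prime p \<and> p < N} \<le> card (large_primes N \<union> ({..sieve_level N} \<union> {2}))"
      by (intro card_mono) (auto simp: finite_large_primes)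
    also have "\<dots> \<le> card (large_primes N) + (card {..sieve_level N} + card {2::nat})"
      using card_Un_le[of "large_primes N" "{..sieve_level N} \<union> {2}"]
        card_Un_le[of "{..sieve_level N}" "{2}"] by linarith
    finally have "real (card {p. prime p \<and> p < N}) \<le> real (card (large_primes N)) + real (sieve_level N) + 2"
      by simp
    moreover have "real (sieve_level N) \<le> sqrt (real N)"
      using elim by (intro sieve_level_le_sqrt) auto
    ultimately show ?case using Chebyshev_lower_bound[OF elim(2)] elim(1) by linarith
  qed
qed

text \<open>
  Cauchy--Schwarz with \<open>M\<close> twin members gives \<open>(M * N / (8 ln N))\<^sup>2\<close> divided by an energy of order
  \<open>M * N\<^sup>2 / ln\<^sup>4 N\<close>: one factor \<open>M\<close> and two logarithms remain, and the powers of \<open>N\<close> cancel.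
\<close>

lemma card_sums_ge:
  "\<forall>\<^sub>F N in at_top. real (card (twins_below N)) * (ln (real N))\<^sup>2
     \<le> 64 * energy_const * real (card ((\<lambda>(p, t). p + t) ` (large_primes N \<times> twins_below N)))"
  using card_large_primes_ge eventually_ge_at_top[of 2]
proof eventually_elim
  case (elim N)
  define Q where "Q = large_primes N \<times> twins_below N"
  define L where "L = ln (real N)"
  define M where "M = real (card (twins_below N))"
  define R where "R = real (card ((\<lambda>(p, t). p + t) ` Q))"
  have L: "L > 0" using elim by (simp add: L_def)
  have N: "real N > 0" using elim by simp
  have R: "R \<ge> 0" by (simp add: R_def)
  have "(real N / (8 * L))\<^sup>2 * M\<^sup>2 = (real N / (8 * L) * M)\<^sup>2" by (simp only: power_mult_distrib)
  also have "\<dots> \<le> (real (card Q))\<^sup>2"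
  proof (rule power_mono)
    have "real N / (8 * L) * M \<le> real (card (large_primes N)) * M"
      using elim by (intro mult_right_mono) (auto simp: M_def L_def)
    then show "real N / (8 * L) * M \<le> real (card Q)"
      by (simp add: Q_def M_def card_cartesian_product)
    show "0 \<le> real N / (8 * L) * M" using L by (simp add: M_def)
  qed
  also have "\<dots> \<le> R * (\<Sum>x\<in>Q. real (card {y \<in> Q. (\<lambda>(p, t). p + t) y = (\<lambda>(p, t). p + t) x}))"
    unfolding R_def by (rule card_squared_le_card_image_mult_energy)
      (simp add: Q_def finite_large_primes finite_twins_below)
  also have "(\<Sum>x\<in>Q. real (card {y \<in> Q. (\<lambda>(p, t). p + t) y = (\<lambda>(p, t). p + t) x}))
      = (\<Sum>(p, t)\<in>Q. real (card {(p', s) \<in> Q. p' + s = p + t}))"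
    by (intro sum.cong refl) (auto intro!: arg_cong[where f = card])
  also have "R * \<dots> \<le> R * (M * (energy_const * ((real N)\<^sup>2 / L ^ 4)))"
    using energy_le[of N] elim R unfolding Q_def M_def L_def by (intro mult_left_mono) auto
  finally have main: "(real N / (8 * L))\<^sup>2 * M\<^sup>2 \<le> R * (M * (energy_const * ((real N)\<^sup>2 / L ^ 4)))" .
  have "M * L\<^sup>2 \<le> 64 * energy_const * R"
  proof (cases "M = 0")
    case True
    then show ?thesis using R by (simp add: energy_const_def)
  next
    case False
    then have "M > 0" by (simp add: M_def)
    define c where "c = (real N)\<^sup>2 * M / (64 * L ^ 4)"
    have "c > 0" using L N \<open>M > 0\<close> by (simp add: c_def)
    have "c * (M * L\<^sup>2) = (real N / (8 * L))\<^sup>2 * M\<^sup>2"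
      using L by (simp add: c_def power_divide power_mult_distrib field_simps power2_eq_square power4_eq_xxxx)
    also note main
    also have "R * (M * (energy_const * ((real N)\<^sup>2 / L ^ 4))) = c * (64 * energy_const * R)"
      by (simp add: c_def)
    finally show ?thesis using \<open>c > 0\<close> by simp
  qed
  then show ?case by (simp add: M_def L_def R_def Q_def)
qed

lemma sums_in_prime_plus_twin:
  "(\<lambda>(p, t). p + t) ` (large_primes N \<times> twins_below N) \<subseteq> {n \<in> prime_plus_twin. 1 \<le> n \<and> n + 2 \<le> 2 * N}"
proof (rule image_subsetI)
  fix x assume "x \<in> large_primes N \<times> twins_below N"
  then obtain p t where x: "x = (p, t)" and p: "prime p" "odd p" "p < N" and t: "t \<in> twin_members" "t < N"
    by (auto simp: large_primes_def twins_below_def)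
  have "p + t \<in> prime_plus_twin"
    using p t odd_twin_member[OF t(1)] by (auto simp: prime_plus_twin_def)
  moreover have "1 \<le> p" using p(1) by (rule prime_ge_1_nat)
  ultimately show "(case x of (p, t) \<Rightarrow> p + t) \<in> {n \<in> prime_plus_twin. 1 \<le> n \<and> n + 2 \<le> 2 * N}"
    using x p t by simp
qed

theorem theorem1:
  shows "\<exists>K::real. K > 0 \<and>
    (\<forall>z\<^sub>0::real. z\<^sub>0 \<ge> 3 \<longrightarrow>
      (\<exists>x\<^sub>0::real. \<forall>c::real. c > 0 \<longrightarrow>
        (\<forall>z::real. z \<ge> z\<^sub>0 \<longrightarrow> real (twin_count z) \<ge> c * z / (ln z)\<^sup>2) \<longrightarrow>
          (\<forall>y::real. y \<ge> 2 * x\<^sub>0 \<longrightarrow>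
            real (card {n \<in> prime_plus_twin. 1 \<le> real n \<and> real n \<le> y}) \<ge> c / K * (y / 2)) \<and>
          Liminf at_top (\<lambda>y::real.
            ereal (real (card {n \<in> prime_plus_twin. real n \<le> y}) / (y / 2))) \<ge> ereal (c / K) \<and>
          c / K > 0))"
proof -
  define K where "K = 64 * energy_const"
  have K: "K > 0" by (simp add: K_def energy_const_def)
  obtain N0 where N0: "\<And>N. N \<ge> N0 \<Longrightarrow> real (card (twins_below N)) * (ln (real N))\<^sup>2
      \<le> K * real (card ((\<lambda>(p, t). p + t) ` (large_primes N \<times> twins_below N)))"
    using card_sums_ge unfolding eventually_at_top_linorder K_def by blast
  have count: "c / K * (y / 2) \<le> real (card {n \<in> prime_plus_twin. 1 \<le> real n \<and> real n \<le> y})"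
    if z0: "z0 \<ge> 3" and y: "y \<ge> 2 * max z0 (real N0)" and c: "c > 0"
      and twins: "\<And>z. z \<ge> z0 \<Longrightarrow> c * z / (ln z)\<^sup>2 \<le> real (twin_count z)" for z0 y c :: real
  proof -
    define z where "z = y / 2"
    \<comment> \<open>the bounds \<open>p, t < N\<close> then read \<open>p, t \<le> z\<close>, so that \<open>p + t \<le> y\<close>\<close>
    define N where "N = nat \<lfloor>z\<rfloor> + 1"
    have z: "z \<ge> 3" "z \<ge> z0" "z \<ge> real N0" using y z0 by (auto simp: z_def)
    have below: "s < N \<longleftrightarrow> real s \<le> z" for s
    proof -
      have "0 \<le> \<lfloor>z\<rfloor>" using z by simp
      then have "s < N \<longleftrightarrow> int s \<le> \<lfloor>z\<rfloor>" by (simp add: N_def less_Suc_eq_le le_nat_iff)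
      then show ?thesis by (simp add: le_floor_iff)
    qed
    have zN: "z < real N" using below[of N] by simp
    have "c * z = c * z / (ln z)\<^sup>2 * (ln z)\<^sup>2" using z by simp
    also have "\<dots> \<le> real (twin_count z) * (ln (real N))\<^sup>2"
      using twins[OF z(2)] z zN by (intro mult_mono power_mono ln_mono) auto
    also have "twin_count z = card (twins_below N)"
      by (simp add: twin_count_def twins_below_def below)
    also have "real (card (twins_below N)) * (ln (real N))\<^sup>2
        \<le> K * real (card ((\<lambda>(p, t). p + t) ` (large_primes N \<times> twins_below N)))"
      using N0[of N] z zN by linarith
    also have "card ((\<lambda>(p, t). p + t) ` (large_primes N \<times> twins_below N))
        \<le> card {n \<in> prime_plus_twin. 1 \<le> real n \<and> real n \<le> y}"
    proof (rule card_mono)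
      show "finite {n \<in> prime_plus_twin. 1 \<le> real n \<and> real n \<le> y}"
        by (rule finite_subset[of _ "{..nat \<lfloor>y\<rfloor>}"]) (auto simp: le_nat_floor)
      have "real n \<le> y" if "n + 2 \<le> 2 * N" for n
      proof -
        have "real (N - 1) \<le> z" using below[of "N - 1"] by (simp add: N_def)
        then have "2 * (real N - 1) \<le> y" by (simp add: N_def z_def)
        moreover have "real (n + 2) \<le> real (2 * N)" using that by (simp only: of_nat_le_iff)
        ultimately show ?thesis by simp
      qed
      then show "(\<lambda>(p, t). p + t) ` (large_primes N \<times> twins_below N)
          \<subseteq> {n \<in> prime_plus_twin. 1 \<le> real n \<and> real n \<le> y}"
        using sums_in_prime_plus_twin[of N] by auto
    qed
    finally have "c * z \<le> K * real (card {n \<in> prime_plus_twin. 1 \<le> real n \<and> real n \<le> y})"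
      using K by simp
    then show ?thesis using K by (simp add: z_def divide_simps mult.commute)
  qed
  show ?thesis
  proof (rule exI[of _ K], intro conjI K allI impI)
    fix z0 :: real assume z0: "z0 \<ge> 3"
    show "\<exists>x\<^sub>0::real. \<forall>c::real. c > 0 \<longrightarrow>
        (\<forall>z::real. z \<ge> z0 \<longrightarrow> real (twin_count z) \<ge> c * z / (ln z)\<^sup>2) \<longrightarrow>
          (\<forall>y::real. y \<ge> 2 * x\<^sub>0 \<longrightarrow>
            real (card {n \<in> prime_plus_twin. 1 \<le> real n \<and> real n \<le> y}) \<ge> c / K * (y / 2)) \<and>
          Liminf at_top (\<lambda>y::real.
            ereal (real (card {n \<in> prime_plus_twin. real n \<le> y}) / (y / 2))) \<ge> ereal (c / K) \<and>
          c / K > 0"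
    proof (rule exI[of _ "max z0 (real N0)"], intro allI impI conjI)
      fix c :: real
      assume c: "c > 0" and twins: "\<forall>z::real. z \<ge> z0 \<longrightarrow> real (twin_count z) \<ge> c * z / (ln z)\<^sup>2"
      show "c / K > 0" using c K by simp
      show le: "c / K * (y / 2) \<le> real (card {n \<in> prime_plus_twin. 1 \<le> real n \<and> real n \<le> y})"
        if "y \<ge> 2 * max z0 (real N0)" for y
        using count[OF z0 that c] twins by blast
      have "\<forall>\<^sub>F y in at_top. ereal (c / K) \<le> ereal (real (card {n \<in> prime_plus_twin. real n \<le> y}) / (y / 2))"
        using eventually_ge_at_top[of "2 * max z0 (real N0)"]
      proof eventually_elim
        case (elim y)
        have "card {n \<in> prime_plus_twin. 1 \<le> real n \<and> real n \<le> y} \<le> card {n \<in> prime_plus_twin. real n \<le> y}"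
        proof (rule card_mono)
          show "finite {n \<in> prime_plus_twin. real n \<le> y}"
            by (rule finite_subset[of _ "{..nat \<lfloor>y\<rfloor>}"]) (auto simp: le_nat_floor)
        qed auto
        then have "c / K * (y / 2) \<le> real (card {n \<in> prime_plus_twin. real n \<le> y})"
          using le[OF elim] by linarith
        moreover have "y / 2 > 0" using elim z0 by simp
        ultimately show ?case unfolding ereal_less_eq by (simp add: le_divide_eq)
      qed
      then show "Liminf at_top (\<lambda>y::real.
            ereal (real (card {n \<in> prime_plus_twin. real n \<le> y}) / (y / 2))) \<ge> ereal (c / K)"
        by (rule Liminf_bounded)
    qed
  qed
qed

end
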